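(* For every integer $n \ge 1$ and every integer $d \ge 0$, $$\lambda(n,d) \le \frac{n+2}{n}\, d + (2n+2).$$ In particular, $\alpha(n) \le \frac{n+2}{n}$.
   Context: Let $S^n_{n+2}$ denote the boundary complex of the $(n+1)$-simplex, with vertex set $\{1,\dots,n+2\}$; it is a triangulation of the $n$-sphere. For a triangulation $T$ of the $n$-sphere $\mathbb{S}^n$ with vertex set $V(T)$, any map (coloring) $L: V(T) \to \{1,\dots,n+2\}$ extends linearly over the faces of $T$ to a simplicial map $f_L: \mathbb{S}^n \to S^n_{n+2}$, which has a well-defined (Brouwer) degree $\deg f_L \in \mathbb{Z}$ (with respect to fixed orientations). For integers $n\ge 1$ and $d$, $\lambda(n,d)$ denotes the smallest number of vertices of a triangulation $T$ of $\mathbb{S}^n$ for which there exists a coloring $L: V(T)\to\{1,\dots,n+2\}$ with $\deg f_L = d$. Define $\alpha(n) := \limsup_{d\to\infty} \frac{\lambda(n,d)}{d}$. *)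

theory Defs
  imports "HOL-Homology.Homology" "HOL-Library.Extended_Real"
begin

definition abstract_simplicial_complex :: "'v set set \<Rightarrow> bool" where
  "abstract_simplicial_complex K \<longleftrightarrow>
     (\<forall>\<sigma>\<in>K. finite \<sigma> \<and> \<sigma> \<noteq> {}) \<and> (\<forall>\<sigma>\<in>K. \<forall>\<tau>. \<tau> \<noteq> {} \<and> \<tau> \<subseteq> \<sigma> \<longrightarrow> \<tau> \<in> K)"

definition vertices :: "'v set set \<Rightarrow> 'v set" where
  "vertices K = \<Union>K"

text \<open>Points of the geometric realization are given by barycentric coordinates. The product
  topology is the right one for finite complexes, the only ones used below.\<close>

definition realization :: "'v set set \<Rightarrow> ('v \<Rightarrow> real) topology" where
  "realization K = subtopology (powertop_real UNIV)
     {x. (\<forall>v. 0 \<le> x v) \<and> {v. x v \<noteq> 0} \<in> K \<and> (\<Sum>v\<in>vertices K. x v) = 1}"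

text \<open>The linear extension over the faces of \<open>K\<close> of a vertex map \<open>L\<close>.\<close>

definition simplicial_extension :: "'v set set \<Rightarrow> ('v \<Rightarrow> 'w) \<Rightarrow> ('v \<Rightarrow> real) \<Rightarrow> ('w \<Rightarrow> real)" where
  "simplicial_extension K L x = (\<lambda>w. \<Sum>v | v \<in> vertices K \<and> L v = w. x v)"

text \<open>A triangulation of the \<open>n\<close>-sphere is a finite complex together with a homeomorphism from the
  sphere onto its realization; the homeomorphism also carries the orientation of the complex.
  As the complexes are finite, taking vertices in \<open>nat\<close> is no restriction.\<close>

definition sphere_triangulation ::
    "nat \<Rightarrow> nat set set \<Rightarrow> ((nat \<Rightarrow> real) \<Rightarrow> (nat \<Rightarrow> real)) \<Rightarrow> bool" where
  "sphere_triangulation n K h \<longleftrightarrow>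
     finite K \<and> abstract_simplicial_complex K \<and> homeomorphic_map (nsphere n) (realization K) h"

definition simplex_boundary :: "nat \<Rightarrow> nat set set" where
  "simplex_boundary n = {\<sigma>. \<sigma> \<noteq> {} \<and> \<sigma> \<subset> {1..n+2}}"

text \<open>The identification of the realization of \<^term>\<open>simplex_boundary n\<close> with the sphere, which fixes
  the orientation of the former. Forgetting the last barycentric coordinate embeds the simplex in
  Euclidean \<open>(n+1)\<close>-space; its boundary is then projected radially from the barycentre.
  The colour \<open>i+1\<close> corresponds to the coordinate \<open>i\<close>, as \<^term>\<open>nsphere n\<close> uses \<open>0, \<dots>, n\<close>.\<close>

definition boundary_to_sphere :: "nat \<Rightarrow> (nat \<Rightarrow> real) \<Rightarrow> (nat \<Rightarrow> real)" where
  "boundary_to_sphere n x =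
     (let y = (\<lambda>i. if i \<le> n then x (i + 1) - 1 / real (n + 2) else 0)
      in (\<lambda>i. y i / sqrt (\<Sum>j\<le>n. (y j)\<^sup>2)))"

definition coloring_degree ::
    "nat \<Rightarrow> nat set set \<Rightarrow> ((nat \<Rightarrow> real) \<Rightarrow> (nat \<Rightarrow> real)) \<Rightarrow> (nat \<Rightarrow> nat) \<Rightarrow> int" where
  "coloring_degree n K h L =
     Brouwer_degree2 n (boundary_to_sphere n \<circ> simplicial_extension K L \<circ> h)"

text \<open>The infimum is taken in \<^typ>\<open>enat\<close>, so that it is \<open>\<infinity>\<close>, and not a junk natural number,
  if no such triangulation and coloring exist; otherwise it is a minimum.\<close>

definition lambda :: "nat \<Rightarrow> int \<Rightarrow> enat" where
  "lambda n d = Inf {enat (card (vertices K)) | K h L.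
     sphere_triangulation n K h \<and> L ` vertices K \<subseteq> {1..n+2} \<and> coloring_degree n K h L = d}"

definition alpha :: "nat \<Rightarrow> ereal" where
  "alpha n = limsup (\<lambda>d::nat. ereal_of_enat (lambda n (int d)) / ereal (real d))"

end

theory Submission
  imports Defs
begin

text \<open>Stacking a new vertex on a facet whose vertices carry all colours but \<open>c\<close>, and giving it the colour
  \<open>c\<close>, replaces the facet by \<open>n + 1\<close> facets of the opposite sign, and changes the degree by minus
  the sign of the facet. Start from the boundary of the simplex, where all facets are positive and the
  degree is \<open>1\<close>. Stacking a positive facet and then the \<open>n + 1\<close> negative facets so created costs
  \<open>n + 2\<close> vertices and raises the degree by \<open>n\<close>; this is repeated, and a last, incomplete round
  adjusts the degree modulo \<open>n\<close>.

  The degree is computed with singular chains. If \<open>z\<close> is the signed sum of the facets, each ordered by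
  colour, then the colouring maps \<open>z\<close> to \<open>d \<cdot> z\<^sub>0\<close>, where \<open>z\<^sub>0\<close> is the boundary of the standard
  simplex, and stacking changes \<open>z\<close> by the boundary of one full simplex. The homeomorphism \<open>\<Psi>\<close> to
  the boundary of the simplex that undoes all the stackings maps \<open>z\<close> to a cycle homologous to \<open>z\<^sub>0\<close>, so
  the colouring composed with the inverse of \<open>\<Psi>\<close> multiplies the class of \<open>z\<^sub>0\<close> by \<open>d\<close>. As this class
  is nonzero in an infinite cyclic group, the degree is \<open>d\<close>.\<close>

subsection \<open>The boundary of the standard simplex is not null-homologous\<close>

lemma continuous_map_Min:
  assumes "finite I" "I \<noteq> {}" "\<And>i. i \<in> I \<Longrightarrow> continuous_map X euclideanreal (f i)"
  shows "continuous_map X euclideanreal (\<lambda>x. Min ((\<lambda>i. f i x) ` I))"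
  using assms
proof (induction I rule: finite_ne_induct)
  case (insert i I)
  then have "continuous_map X euclideanreal (\<lambda>x. min (f i x) (Min ((\<lambda>i. f i x) ` I)))"
    by (intro continuous_map_real_min) auto
  with insert show ?case
    by simp
qed auto

lemma continuous_map_coordinate: "continuous_map (subtopology (powertop_real UNIV) S) euclideanreal (\<lambda>x. x i)"
  by (intro continuous_map_from_subtopology continuous_map_product_projection) auto

lemma singular_chain_subtopology_Int:
  assumes "singular_chain p (subtopology X S) c" "singular_chain p (subtopology X T) c"
  shows "singular_chain p (subtopology X (S \<inter> T)) c"
  using assms by (auto simp: singular_chain_subtopology)

section \<open>Iterated barycentric subdivision of chains\<close>

lemma singular_chain_iterated_subdivision:
  "singular_chain p X c \<Longrightarrow> singular_chain p X ((singular_subdivision p ^^ N) c)"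
  by (induction N) (auto simp: singular_chain_singular_subdivision)

lemma chain_boundary_iterated_subdivision:
  "singular_chain p X c \<Longrightarrow>
     chain_boundary p ((singular_subdivision p ^^ N) c) =
     (singular_subdivision (p - 1) ^^ N) (chain_boundary p c)"
  by (induction N)
     (auto simp: chain_boundary_singular_subdivision [OF singular_chain_iterated_subdivision])

lemma homologous_rel_iterated_subdivision:
  assumes "singular_relcycle p X S c"
  shows "homologous_rel p X S ((singular_subdivision p ^^ N) c) c"
proof (induction N)
  case (Suc N)
  have "singular_relcycle p X S ((singular_subdivision p ^^ N) c)"
    using Suc assms homologous_rel_singular_relcycle by blast
  then have "homologous_rel p X S ((singular_subdivision p ^^ Suc N) c) ((singular_subdivision p ^^ N) c)"
    by (simp add: homologous_rel_singular_subdivision)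
  with Suc show ?case
    using homologous_rel_trans by blast
qed auto

section \<open>The fundamental simplex, its faces and its boundary\<close>

definition boundary_of_standard_simplex :: "nat \<Rightarrow> (nat \<Rightarrow> real) set" where
  "boundary_of_standard_simplex p = {x \<in> standard_simplex p. \<exists>i\<le>p. x i = 0}"

text \<open>The identity is restricted because singular simplices are extensional: off the standard
  simplex they take the value \<open>undefined\<close>.\<close>

definition fundamental_simplex :: "nat \<Rightarrow> (nat \<Rightarrow> real) chain" where
  "fundamental_simplex p = frag_of (restrict id (standard_simplex p))"

lemma singular_chain_fundamental_simplex:
  "standard_simplex p \<subseteq> S \<Longrightarrow> singular_chain p (subtopology (powertop_real UNIV) S) (fundamental_simplex p)"
  unfolding fundamental_simplex_def singular_chain_of
  by (simp add: simplicial_imp_singular_simplex)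

lemma singular_chain_face_fundamental:
  assumes "k \<le> Suc m"
  shows "singular_chain m (subtopology (powertop_real UNIV) {x \<in> standard_simplex (Suc m). x k = 0})
          (frag_of (singular_face (Suc m) k (restrict id (standard_simplex (Suc m)))))"
proof -
  have "singular_simplex (Suc m) (subtopology (powertop_real UNIV) (standard_simplex (Suc m)))
          (restrict id (standard_simplex (Suc m)))"
    by (simp add: simplicial_imp_singular_simplex)
  from singular_simplex_singular_face [OF this _ assms]
  have "singular_simplex m (subtopology (powertop_real UNIV) (standard_simplex (Suc m)))
          (singular_face (Suc m) k (restrict id (standard_simplex (Suc m))))"
    by simp
  moreover have "singular_face (Suc m) k (restrict id (standard_simplex (Suc m))) x k = 0"
    if "x \<in> standard_simplex m" for x
    using that assms simplical_face_in_standard_simplex [of "Suc m" k x]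
    by (simp add: singular_face_def simplical_face_def)
  ultimately show ?thesis
    unfolding singular_chain_of singular_simplex_subtopology by auto
qed

text \<open>Points of a standard simplex are sequences that vanish beyond its dimension, so
  inserting a zero at the last place changes nothing. Thus the last face is literally the
  fundamental simplex one dimension lower, which makes it the face to single out in the induction on
  the dimension.\<close>

lemma singular_face_last_fundamental:
  "singular_face (Suc m) (Suc m) (restrict id (standard_simplex (Suc m))) = restrict id (standard_simplex m)"
proof -
  have "simplical_face (Suc m) x = x" if "x \<in> standard_simplex m" for x :: "nat \<Rightarrow> real"
    using that by (auto simp: simplical_face_def standard_simplex_def fun_eq_iff)
  then have "singular_face (Suc m) (Suc m) (restrict id (standard_simplex (Suc m))) x =
               restrict id (standard_simplex m) x" for x
    using standard_simplex_mono [of m "Suc m"] by (auto simp: singular_face_def)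
  then show ?thesis
    by blast
qed

lemma chain_boundary_fundamental_simplex:
  "chain_boundary (Suc m) (fundamental_simplex (Suc m)) =
     (\<Sum>k\<le>Suc m. frag_cmul ((-1) ^ k)
        (frag_of (singular_face (Suc m) k (restrict id (standard_simplex (Suc m))))))"
  by (simp add: fundamental_simplex_def chain_boundary_of)

lemma singular_chain_boundary_fundamental_simplex:
  assumes "1 \<le> p"
  shows "singular_chain (p - 1) (subtopology (powertop_real UNIV) (boundary_of_standard_simplex p))
           (chain_boundary p (fundamental_simplex p))"
proof -
  obtain m where p: "p = Suc m"
    using assms not0_implies_Suc by force
  have "singular_chain m (subtopology (powertop_real UNIV) (boundary_of_standard_simplex p))
           (frag_of (singular_face (Suc m) k (restrict id (standard_simplex (Suc m)))))" if "k \<le> Suc m" for k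
    by (rule singular_chain_mono [OF singular_chain_face_fundamental [OF that]])
       (use that p in \<open>auto simp: boundary_of_standard_simplex_def\<close>)
  then show ?thesis
    unfolding p chain_boundary_fundamental_simplex
    by (intro singular_chain_sum singular_chain_cmul) auto
qed

text \<open>As the coordinates sum to 1, the condition on the domain excludes exactly the
  barycentre. The retraction is the radial projection from it: subtract the least coordinate and
  rescale.\<close>

lemma punctured_standard_simplex_retraction:
  obtains r where
    "continuous_map
       (subtopology (powertop_real UNIV) {x \<in> standard_simplex m. \<exists>i\<le>m. x i < 1 / (real m + 1)})
       (subtopology (powertop_real UNIV) (boundary_of_standard_simplex m)) r"
    "\<And>x. x \<in> boundary_of_standard_simplex m \<Longrightarrow> r x = x"
proof
  define \<mu> where "\<mu> = (\<lambda>x::nat\<Rightarrow>real. Min (x ` {..m}))"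
  \<comment> \<open>After \<open>\<mu> x\<close> has been subtracted from all m+1 coordinates their
    sum is the denominator used here. It vanishes only at the barycentre, and it is 1 on the
    boundary, where \<open>\<mu> x\<close> is 0.\<close>
  define r where "r = (\<lambda>x::nat\<Rightarrow>real. \<lambda>i. if i \<le> m then (x i - \<mu> x) / (1 - (real m + 1) * \<mu> x) else 0)"
  let ?D = "{x \<in> standard_simplex m. \<exists>i\<le>m. x i < 1 / (real m + 1)}"
  have \<mu>_le: "\<mu> x \<le> x i" if "i \<le> m" for x i
    using that by (simp add: \<mu>_def)
  have \<mu>_ex: "\<exists>i\<le>m. \<mu> x = x i" for x
  proof -
    have "\<mu> x \<in> x ` {..m}"
      unfolding \<mu>_def by (rule Min_in) auto
    then show ?thesis
      by blast
  qed
  have pos: "0 < 1 - (real m + 1) * \<mu> x" if "x \<in> ?D" for x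
  proof -
    from that obtain i where i: "i \<le> m" "x i < 1 / (real m + 1)"
      by auto
    from \<mu>_le [OF i(1)] i(2) have "\<mu> x < 1 / (real m + 1)"
      by (rule le_less_trans)
    then show ?thesis
      by (simp add: field_simps)
  qed
  have r_in: "r x \<in> boundary_of_standard_simplex m" if x: "x \<in> ?D" for x
  proof -
    have sum1: "(\<Sum>i\<le>m. x i) = 1"
      using x by (auto simp: standard_simplex_def)
    have "(\<Sum>i\<le>m. r x i) = (\<Sum>i\<le>m. x i - \<mu> x) / (1 - (real m + 1) * \<mu> x)"
      by (simp add: r_def sum_divide_distrib)
    also have "\<dots> = 1"
      using pos [OF x] by (simp add: sum_subtractf sum1 algebra_simps)
    finally have s: "(\<Sum>i\<le>m. r x i) = 1" .
    have nn: "0 \<le> r x i" for i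
      using pos [OF x] \<mu>_le [of i x] by (simp add: r_def)
    have "r x i \<le> 1" for i
    proof (cases "i \<le> m")
      case True
      then show ?thesis
        using member_le_sum [of i "{..m}" "r x"] nn s by auto
    qed (simp add: r_def)
    moreover obtain i where "i \<le> m" "\<mu> x = x i"
      using \<mu>_ex by blast
    then have "\<exists>i\<le>m. r x i = 0"
      by (auto simp: r_def)
    ultimately show ?thesis
      using s nn by (auto simp: boundary_of_standard_simplex_def standard_simplex_def r_def)
  qed
  have cont_\<mu>: "continuous_map (subtopology (powertop_real UNIV) S) euclideanreal \<mu>" for S
    unfolding \<mu>_def by (rule continuous_map_Min) (auto intro: continuous_map_coordinate)
  show "continuous_map (subtopology (powertop_real UNIV) ?D)
         (subtopology (powertop_real UNIV) (boundary_of_standard_simplex m)) r"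
    unfolding continuous_map_in_subtopology continuous_map_componentwise_UNIV
  proof (intro conjI allI)
    fix i
    show "continuous_map (subtopology (powertop_real UNIV) ?D) euclideanreal (\<lambda>x. r x i)"
    proof (cases "i \<le> m")
      case True
      have "continuous_map (subtopology (powertop_real UNIV) ?D) euclideanreal
              (\<lambda>x. (x i - \<mu> x) / (1 - (real m + 1) * \<mu> x))"
        by (intro continuous_map_real_divide continuous_map_diff continuous_map_coordinate cont_\<mu>
              continuous_map_real_mult continuous_map_const [THEN iffD2]) (use pos in fastforce)+
      with True show ?thesis
        by (simp add: r_def)
    qed (simp add: r_def)
  qed (use r_in in auto)
  show "r x = x" if "x \<in> boundary_of_standard_simplex m" for x
  proof -
    have x: "x \<in> standard_simplex m" and "\<exists>i\<le>m. x i = 0"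
      using that by (auto simp: boundary_of_standard_simplex_def)
    then obtain j where "j \<le> m" "x j = 0"
      by blast
    then have "\<mu> x \<le> 0"
      using \<mu>_le by metis
    moreover have "0 \<le> \<mu> x"
      using \<mu>_ex [of x] x by (auto simp: standard_simplex_def)
    ultimately show ?thesis
      using x by (auto simp: r_def standard_simplex_def fun_eq_iff)
  qed
qed

text \<open>If \<open>w\<close> bounds the boundary of the simplex, then a subdivision of \<open>w\<close> is \<open>d + e\<close>, where \<open>d\<close> lies in
  the last face and \<open>e\<close> avoids its barycentre. Hence the last face minus the boundary of \<open>d\<close> avoids its
  barycentre, and its retraction bounds the boundary of the last face.\<close>

lemma fundamental_boundary_nonzero_step:
  assumes m: "1 \<le> m"
    and bd: "singular_relboundary m (subtopology (powertop_real UNIV) (boundary_of_standard_simplex (Suc m))) {}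
               (chain_boundary (Suc m) (fundamental_simplex (Suc m)))"
  shows "singular_relboundary (m - 1) (subtopology (powertop_real UNIV) (boundary_of_standard_simplex m)) {}
           (chain_boundary m (fundamental_simplex m))"
proof -
  let ?T = "powertop_real (UNIV::nat set)"
  let ?B = "boundary_of_standard_simplex (Suc m)"
  let ?X = "subtopology ?T ?B"
  let ?Y = "subtopology ?T (boundary_of_standard_simplex m)"
  \<comment> \<open>\<open>\<Lambda>\<close> is the union of the faces other than the last one.
    \<open>D\<close> is an open neighbourhood of it that leaves out only the barycentre of the last
    face: if the first m+1 coordinates are all at least 1/(m+1), they equal it and the remaining one
    is 0.\<close>
  define \<Lambda> where "\<Lambda> = {x \<in> ?B. \<exists>i\<le>m. x i = 0}"
  define D where "D = {x \<in> ?B. \<exists>i\<le>m. x i < 1 / (real m + 1)}"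
  define s :: int where "s = (-1) ^ Suc m"
  define \<kappa> where "\<kappa> = (\<Sum>k\<le>m. frag_cmul ((-1) ^ k)
        (frag_of (singular_face (Suc m) k (restrict id (standard_simplex (Suc m))))))"
  obtain w where w: "singular_chain (Suc m) ?X w"
    and bw: "chain_boundary (Suc m) w = chain_boundary (Suc m) (fundamental_simplex (Suc m))"
    using bd by (auto simp: singular_boundary)
  have bw': "chain_boundary (Suc m) w = \<kappa> + frag_cmul s (fundamental_simplex m)"
    unfolding bw chain_boundary_fundamental_simplex sum.atMost_Suc singular_face_last_fundamental
    by (simp add: \<kappa>_def s_def fundamental_simplex_def)
  have \<Lambda>_sub: "\<Lambda> \<subseteq> D"
    by (auto simp: \<Lambda>_def D_def)
  have \<kappa>: "singular_chain m (subtopology ?T \<Lambda>) \<kappa>"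
    unfolding \<kappa>_def
  proof (intro singular_chain_sum singular_chain_cmul)
    fix k assume "k \<in> {..m}"
    then have "k \<le> m" by simp
    then show "singular_chain m (subtopology ?T \<Lambda>)
       (frag_of (singular_face (Suc m) k (restrict id (standard_simplex (Suc m)))))"
      by (intro singular_chain_mono [OF singular_chain_face_fundamental])
         (auto simp: \<Lambda>_def boundary_of_standard_simplex_def intro: le_SucI)
  qed
  have "\<Lambda> = (\<Union>i\<le>m. {x \<in> topspace ?X. x i \<in> {0}})"
    by (auto simp: \<Lambda>_def)
  also have "closedin ?X \<dots>"
  proof (rule closedin_Union)
    have "closedin ?X {x \<in> topspace ?X. x i \<in> {0}}" for i
      by (rule closedin_continuous_map_preimage [OF continuous_map_coordinate]) simp
    then show "closedin ?X S" if "S \<in> (\<lambda>i. {x \<in> topspace ?X. x i \<in> {0}}) ` {..m}" for S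
      using that by blast
  qed auto
  finally have closed: "closedin ?X \<Lambda>" .
  have "D = (\<Union>i\<le>m. {x \<in> topspace ?X. x i \<in> {..<1 / (real m + 1)}})"
    by (auto simp: D_def)
  also have "openin ?X \<dots>"
  proof (rule openin_Union)
    have "openin ?X {x \<in> topspace ?X. x i \<in> {..<1 / (real m + 1)}}" for i
      by (rule openin_continuous_map_preimage [OF continuous_map_coordinate]) simp
    then show "openin ?X S" if "S \<in> (\<lambda>i. {x \<in> topspace ?X. x i \<in> {..<1 / (real m + 1)}}) ` {..m}" for S
      using that by blast
  qed
  finally have opn: "openin ?X D" .
  \<comment> \<open>This is the hypothesis of excision: after enough subdivisions each simplex of
    \<open>w\<close> avoids \<open>\<Lambda>\<close> or lies in \<open>D\<close>.\<close>
  have "?X closure_of \<Lambda> \<subseteq> ?X interior_of D"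
    using closed opn \<Lambda>_sub by (simp add: closure_of_closedin interior_of_openin)
  moreover have "D \<subseteq> ?B" "singular_chain (Suc m) (subtopology ?X ?B) w"
    using w by (auto simp: D_def subtopology_subtopology)
  ultimately obtain N d e where d: "singular_chain (Suc m) (subtopology ?X (?B - \<Lambda>)) d"
    and e: "singular_chain (Suc m) (subtopology ?X D) e"
    and de: "(singular_subdivision (Suc m) ^^ N) w = d + e"
    by (rule excised_chain_exists)
  \<comment> \<open>A boundary point has a vanishing coordinate; off \<open>\<Lambda>\<close> this
    can only be the last one.\<close>
  have BX: "?B \<inter> (?B - \<Lambda>) \<subseteq> standard_simplex m"
  proof
    fix x assume "x \<in> ?B \<inter> (?B - \<Lambda>)"
    then have x: "x \<in> standard_simplex (Suc m)" and "\<exists>i\<le>Suc m. x i = 0" "\<forall>i\<le>m. x i \<noteq> 0"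
      by (auto simp: \<Lambda>_def boundary_of_standard_simplex_def)
    then have "x (Suc m) = 0"
      using le_Suc_eq by auto
    moreover have "i = Suc m \<or> i > Suc m" if "i > m" for i
      using that by linarith
    ultimately show "x \<in> standard_simplex m"
      using x by (auto simp: standard_simplex_def)
  qed
  have d': "singular_chain (Suc m) (subtopology ?T (standard_simplex m)) d"
    using d BX unfolding subtopology_subtopology by (rule singular_chain_mono)
  have e': "singular_chain (Suc m) (subtopology ?T D) e"
    using e unfolding subtopology_subtopology by (rule singular_chain_mono) auto
  let ?S = "singular_subdivision m ^^ N"
  \<comment> \<open>The chain \<open>y\<close> has two expressions. This one shows that it lies in
    the last face; \<open>y2\<close>, obtained by splitting the boundary of the subdivided
    \<open>w\<close>, shows that it lies in \<open>D\<close>. Together they keep it away from the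
    barycentre, so that the retraction applies.\<close>
  define y where "y = ?S (frag_cmul s (fundamental_simplex m)) - chain_boundary (Suc m) d"
  have S_add: "?S (a + b) = ?S a + ?S b" for a b :: "(nat \<Rightarrow> real) chain"
    by (induction N) (auto simp: singular_subdivision_add)
  have "chain_boundary (Suc m) d + chain_boundary (Suc m) e = ?S (\<kappa> + frag_cmul s (fundamental_simplex m))"
    using chain_boundary_iterated_subdivision [OF w, of N]
    by (simp add: de bw' chain_boundary_add)
  then have y2: "y = chain_boundary (Suc m) e - ?S \<kappa>"
    by (simp add: y_def S_add algebra_simps)
  have fm: "singular_chain m (subtopology ?T (standard_simplex m)) (fundamental_simplex m)"
    by (simp add: singular_chain_fundamental_simplex)
  have sfm: "singular_chain m (subtopology ?T (standard_simplex m)) (frag_cmul s (fundamental_simplex m))"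
    by (intro singular_chain_cmul fm)
  have y_in1: "singular_chain m (subtopology ?T (standard_simplex m)) y"
    unfolding y_def
    by (intro singular_chain_diff singular_chain_iterated_subdivision singular_chain_boundary_alt d' sfm)
  have y_in2: "singular_chain m (subtopology ?T D) y"
    unfolding y2
    by (intro singular_chain_diff singular_chain_iterated_subdivision singular_chain_boundary_alt e'
          singular_chain_mono [OF \<kappa> \<Lambda>_sub])
  let ?P = "{x \<in> standard_simplex m. \<exists>i\<le>m. x i < 1 / (real m + 1)}"
  have y: "singular_chain m (subtopology ?T ?P) y"
    by (rule singular_chain_mono [OF singular_chain_subtopology_Int [OF y_in1 y_in2]]) (auto simp: D_def)
  obtain r where r: "continuous_map (subtopology ?T ?P) ?Y r"
    and r_id: "\<And>x. x \<in> boundary_of_standard_simplex m \<Longrightarrow> r x = x"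
    using punctured_standard_simplex_retraction by blast
  have cb: "singular_chain (m - 1) ?Y (chain_boundary m (fundamental_simplex m))"
    by (rule singular_chain_boundary_fundamental_simplex [OF m])
  let ?S' = "singular_subdivision (m - 1) ^^ N"
  have "chain_boundary m y = chain_boundary m (?S (frag_cmul s (fundamental_simplex m)))"
    using chain_boundary_boundary_alt [OF d'] by (simp add: y_def chain_boundary_diff)
  also have "\<dots> = ?S' (frag_cmul s (chain_boundary m (fundamental_simplex m)))"
    using chain_boundary_iterated_subdivision [OF sfm, of N] by (simp add: chain_boundary_cmul)
  finally have bdy: "chain_boundary m y = ?S' (frag_cmul s (chain_boundary m (fundamental_simplex m)))" .
  have scb: "singular_chain (m - 1) ?Y (frag_cmul s (chain_boundary m (fundamental_simplex m)))"
    by (intro singular_chain_cmul cb)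
  have "chain_boundary m (chain_map m r y) = chain_map (m - 1) r (chain_boundary m y)"
    using chain_boundary_chain_map [OF y] by simp
  \<comment> \<open>The boundary of \<open>y\<close> is a subdivided chain in the boundary of the
    face, where the retraction is the identity.\<close>
  also have "\<dots> = chain_boundary m y"
    unfolding bdy
    by (rule chain_map_id_gen [OF singular_chain_iterated_subdivision [OF scb]]) (use r_id in auto)
  finally have "chain_boundary m (chain_map m r y) = ?S' (frag_cmul s (chain_boundary m (fundamental_simplex m)))"
    by (simp add: bdy)
  moreover have "singular_chain m ?Y (chain_map m r y)"
    by (rule singular_chain_chain_map [OF y r])
  ultimately have "singular_relboundary (m - 1) ?Y {} (?S' (frag_cmul s (chain_boundary m (fundamental_simplex m))))"
    using m by (auto simp: singular_boundary)
  moreover have "singular_relcycle (m - 1) ?Y {} (frag_cmul s (chain_boundary m (fundamental_simplex m)))"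
    using scb chain_boundary_boundary [OF fm] by (simp add: singular_cycle chain_boundary_cmul)
  then have "singular_relboundary (m - 1) ?Y {}
      (?S' (frag_cmul s (chain_boundary m (fundamental_simplex m))) -
       frag_cmul s (chain_boundary m (fundamental_simplex m)))"
    using homologous_rel_iterated_subdivision unfolding homologous_rel_def by blast
  ultimately have "singular_relboundary (m - 1) ?Y {} (frag_cmul s (chain_boundary m (fundamental_simplex m)))"
    using singular_relboundary_diff by fastforce
  \<comment> \<open>Multiplying by the sign \<open>s\<close> once more removes it, since its square
    is 1.\<close>
  then have *: "singular_relboundary (m - 1) ?Y {} (frag_cmul s (frag_cmul s (chain_boundary m (fundamental_simplex m))))"
    by (rule singular_relboundary_cmul)
  have "s * s = 1"
    by (simp add: s_def flip: power_mult_distrib)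
  with * show ?thesis
    by simp
qed

text \<open>The boundary of the segment consists of two points. The segment being connected, every
  singular 1-simplex in this boundary is constant and has equal faces, so every 1-chain there has
  boundary 0. The fundamental simplex, in contrast, has two different end points.\<close>

lemma fundamental_boundary_nonzero_1:
  "\<not> singular_relboundary 0 (subtopology (powertop_real UNIV) (boundary_of_standard_simplex 1)) {}
      (chain_boundary 1 (fundamental_simplex 1))"
proof
  let ?X = "subtopology (powertop_real UNIV) (boundary_of_standard_simplex 1)"
  assume "singular_relboundary 0 ?X {} (chain_boundary 1 (fundamental_simplex 1))"
  then obtain w where w: "singular_chain 1 ?X w"
    and bw: "chain_boundary 1 w = chain_boundary 1 (fundamental_simplex 1)"
    by (auto simp: singular_boundary)
  have "chain_boundary 1 w = 0"
    using w unfolding singular_chain_def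
  proof (induction w rule: frag_induction)
    case (one f)
    then have f: "singular_simplex 1 ?X f"
      by auto
    then have cont: "continuous_map (subtopology (powertop_real UNIV) (standard_simplex 1)) ?X f"
      by (simp add: singular_simplex_def)
    have bd: "x = (\<lambda>i. if i = (0::nat) then 1 else 0) \<or> x = (\<lambda>i. if i = (1::nat) then 1 else 0)"
      if "x \<in> boundary_of_standard_simplex 1" for x
    proof -
      have x: "\<forall>i>1. x i = 0" "x 0 + x 1 = 1" "x 0 = 0 \<or> x 1 = 0"
        using that by (auto simp: boundary_of_standard_simplex_def standard_simplex_def le_Suc_eq)
      show ?thesis
      proof (cases "x 0 = 0")
        case True
        then have "x i = (if i = (1::nat) then 1 else 0)" for i
          using x by (cases "i > 1") (auto simp: not_less le_Suc_eq)
        then show ?thesis by blast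
      next
        case False
        then have "x i = (if i = (0::nat) then 1 else 0)" for i
          using x by (cases "i > 1") (auto simp: not_less le_Suc_eq)
        then show ?thesis by blast
      qed
    qed
    have cont0: "continuous_map (subtopology (powertop_real UNIV) (standard_simplex 1)) euclideanreal (\<lambda>x. f x 0)"
      using continuous_map_compose [OF cont continuous_map_coordinate] by (simp add: o_def)
    have "connectedin euclideanreal ((\<lambda>x. f x 0) ` standard_simplex 1)"
      by (rule connectedin_continuous_map_image [OF cont0])
         (simp add: connectedin_subtopology connectedin_standard_simplex)
    then have conn: "connected ((\<lambda>x. f x 0) ` standard_simplex 1)"
      by simp
    have fin: "f x \<in> boundary_of_standard_simplex 1" if "x \<in> standard_simplex 1" for x
      using continuous_map_image_subset_topspace [OF cont] that by auto
    \<comment> \<open>Coordinate 0 tells the two points apart, so it suffices to follow this one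
      real function; a finite connected set of reals has at most one element.\<close>
    have "(\<lambda>x. f x 0) ` standard_simplex 1 \<subseteq> {0, 1}"
    proof
      fix a assume "a \<in> (\<lambda>x. f x 0) ` standard_simplex 1"
      then obtain x where "x \<in> standard_simplex 1" "a = f x 0"
        by blast
      with bd [OF fin [of x]] show "a \<in> {0, 1}" by auto
    qed
    then have "finite ((\<lambda>x. f x 0) ` standard_simplex 1)"
      by (rule finite_subset) auto
    then have const0: "(\<lambda>x. f x 0) ` standard_simplex 1 = {} \<or> (\<exists>a. (\<lambda>x. f x 0) ` standard_simplex 1 = {a})"
      by (rule connected_finite_iff_sing [OF conn, THEN iffD1])
    have const: "f x = f y" if "x \<in> standard_simplex 1" "y \<in> standard_simplex 1" for x y
    proof -
      have "f x 0 = f y 0"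
        using const0 that by (metis (mono_tags, lifting) image_eqI empty_iff singletonD)
      with bd [OF fin [OF that(1)]] bd [OF fin [OF that(2)]] show ?thesis
        by auto
    qed
    have "singular_face 1 0 f = singular_face 1 (Suc 0) f"
      using simplical_face_in_standard_simplex [of 1] const
      by (auto simp: singular_face_def fun_eq_iff)
    then show ?case
      by (simp add: chain_boundary_of)
  next
    case (diff a b)
    then show ?case by (simp add: chain_boundary_diff)
  qed auto
  with bw have "singular_face 1 0 (restrict id (standard_simplex 1)) = singular_face 1 1 (restrict id (standard_simplex 1))"
    by (simp add: fundamental_simplex_def chain_boundary_of frag_of_eq)
  \<comment> \<open>The two faces are distinguished by evaluating coordinate 0 at the only point of
    the 0-simplex.\<close>
  moreover have "singular_face 1 k (restrict id (standard_simplex 1)) (\<lambda>j. if j = 0 then 1 else 0) 0 = (if k = 0 then 0 else 1)"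
    if "k \<le> 1" for k
  proof -
    have "simplical_face k (\<lambda>j. if j = 0 then 1 else 0) \<in> standard_simplex 1"
      using that by (intro simplical_face_in_standard_simplex) auto
    then show ?thesis
      by (simp add: singular_face_def) (simp add: simplical_face_def)
  qed
  ultimately show False
    by (metis le_refl zero_le zero_neq_one)
qed

proposition boundary_of_fundamental_simplex_not_boundary:
  "\<not> singular_relboundary p (subtopology (powertop_real UNIV) (boundary_of_standard_simplex (Suc p))) {}
      (chain_boundary (Suc p) (fundamental_simplex (Suc p)))"
proof (induction p)
  case 0
  show ?case
    using fundamental_boundary_nonzero_1 by simp
next
  case (Suc p)
  then show ?case
    using fundamental_boundary_nonzero_step [of "Suc p"] by auto
qed


subsection \<open>The boundary of the simplex as a sphere\<close>

abbreviation vertex_point :: "nat \<Rightarrow> nat \<Rightarrow> real" where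
  "vertex_point u \<equiv> (\<lambda>v. if v = u then 1 else 0)"

lemma topspace_realization:
  "topspace (realization K) =
     {x. (\<forall>v. 0 \<le> x v) \<and> {v. x v \<noteq> 0} \<in> K \<and> (\<Sum>v\<in>vertices K. x v) = 1}"
  by (simp add: realization_def)

lemma vertices_simplex_boundary: "vertices (simplex_boundary n) = {1..n+2}"
proof
  show "vertices (simplex_boundary n) \<subseteq> {1..n+2}"
    unfolding vertices_def simplex_boundary_def by auto
  show "{1..n+2} \<subseteq> vertices (simplex_boundary n)"
  proof
    fix v assume v: "v \<in> {1..n+2}"
    have "card {v} \<noteq> card {1..n+2}"
      by simp
    then have "{v} \<noteq> {1..n+2}"
      by metis
    with v have "{v} \<in> simplex_boundary n"
      unfolding simplex_boundary_def by blast
    then show "v \<in> vertices (simplex_boundary n)"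
      by (auto simp: vertices_def)
  qed
qed

lemma topspace_realization_simplex_boundary:
  "x \<in> topspace (realization (simplex_boundary n)) \<longleftrightarrow>
     (\<forall>v. 0 \<le> x v) \<and> (\<forall>v. v \<notin> {1..n+2} \<longrightarrow> x v = 0) \<and> (\<exists>v\<in>{1..n+2}. x v = 0) \<and>
     (\<Sum>v=1..n+2. x v) = 1"
proof -
  have "{v. x v \<noteq> 0} \<noteq> {}" if "(\<Sum>v=1..n+2. x v) = 1"
  proof
    assume "{v. x v \<noteq> 0} = {}"
    then have "(\<Sum>v=1..n+2. x v) = 0"
      by (intro sum.neutral) blast
    with that show False
      by simp
  qed
  moreover have "{v. x v \<noteq> 0} \<subset> {1..n+2} \<longleftrightarrow>
      (\<forall>v. v \<notin> {1..n+2} \<longrightarrow> x v = 0) \<and> (\<exists>v\<in>{1..n+2}. x v = 0)"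
    by blast
  ultimately show ?thesis
    unfolding topspace_realization vertices_simplex_boundary
    unfolding simplex_boundary_def mem_Collect_eq
    by blast
qed

lemma continuous_map_coordinate_realization:
  "continuous_map (realization K) euclideanreal (\<lambda>x. x v)"
  unfolding realization_def by (rule continuous_map_coordinate)

text \<open>Colours run from 1 to n+2, coordinates of the sphere from 0 to n. The term split off
  belongs to the barycentric coordinate that \<open>boundary_to_sphere\<close> forgets.\<close>

lemma sum_shift_split: "(\<Sum>v=1..n+2. f v) = (\<Sum>i\<le>n. f (Suc i)) + f (n + 2)" for f :: "nat \<Rightarrow> real"
proof -
  have "(\<Sum>v=1..n+2. f v) = (\<Sum>i=0..Suc n. f (Suc i))"
    using sum.shift_bounds_cl_Suc_ivl [of f 0 "Suc n"] by simp
  then show ?thesis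
    by (simp add: atLeast0AtMost)
qed

text \<open>The inverse is explicit: the ray from the barycentre in a given direction is followed
  until a barycentric coordinate reaches 0.\<close>

lemma homeomorphic_map_boundary_to_sphere:
  "homeomorphic_map (realization (simplex_boundary n)) (nsphere n) (boundary_to_sphere n)"
proof -
  let ?X = "realization (simplex_boundary n)"
  let ?b = "boundary_to_sphere n"
  define I where "I = {1..n+2}"
  define y where "y = (\<lambda>(x::nat\<Rightarrow>real) i. if i \<le> n then x (i + 1) - 1 / real (n + 2) else 0)"
  define r where "r = (\<lambda>x. sqrt (\<Sum>j\<le>n. (y x j)\<^sup>2))"
  have b: "?b x = (\<lambda>i. y x i / r x)" for x
    by (simp add: boundary_to_sphere_def y_def r_def Let_def)
  \<comment> \<open>\<open>w u\<close> prolongs the direction \<open>u\<close> by the forgotten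
    coordinate, so that all entries sum to 0. Its least entry is \<open>- m u\<close>, and dividing
    by \<open>m u\<close> makes the ray in \<open>s u\<close> stop where the first coordinate
    vanishes.\<close>
  define w where "w = (\<lambda>(u::nat\<Rightarrow>real) v. if v = n + 2 then - (\<Sum>i\<le>n. u i) else u (v - 1))"
  define m where "m = (\<lambda>u. - Min (w u ` I))"
  define s where "s = (\<lambda>u v. if v \<in> I then (1 + w u v / m u) / real (n + 2) else 0)"
  have I: "finite I" "I \<noteq> {}"
    by (auto simp: I_def)
  have sum_w: "(\<Sum>v\<in>I. w u v) = 0" for u
    unfolding I_def sum_shift_split by (simp add: w_def)
  \<comment> \<open>If no entry of \<open>w u\<close> were negative, then all would vanish, because
    they sum to 0; this contradicts the norm 1 of \<open>u\<close>.\<close>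
  have m_pos: "0 < m u" if u: "u \<in> topspace (nsphere n)" for u
  proof (rule ccontr)
    assume "\<not> 0 < m u"
    then have "0 \<le> Min (w u ` I)"
      unfolding m_def by linarith
    then have nn: "0 \<le> w u v" if "v \<in> I" for v
      using that I by simp
    have w0: "w u v = 0" if "v \<in> I" for v
      using sum_nonneg_eq_0_iff [of I "w u"] nn that I sum_w by auto
    then have "u i = 0" if "i \<le> n" for i
      using w0 [of "Suc i"] that by (simp add: w_def I_def)
    then show False
      using u by (simp add: nsphere)
  qed
  \<comment> \<open>The radius vanishes only if all barycentric coordinates equal 1/(n+2), whereas a
    point of the boundary has a coordinate 0.\<close>
  have r_pos: "0 < r x" if x: "x \<in> topspace ?X" for x
  proof -
    have "\<exists>i\<le>n. y x i \<noteq> 0"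
    proof (rule ccontr)
      assume "\<not> (\<exists>i\<le>n. y x i \<noteq> 0)"
      then have eq: "x (Suc i) = 1 / real (n + 2)" if "i \<le> n" for i
        using that by (auto simp: y_def)
      have "(\<Sum>v=1..n+2. x v) = 1"
        using x by (simp add: topspace_realization_simplex_boundary)
      then have "real (n + 1) / real (n + 2) + x (n + 2) = 1"
        unfolding sum_shift_split by (simp add: eq)
      then have "x (n + 2) = 1 / real (n + 2)"
        by (simp add: field_simps)
      moreover have "x v = 1 / real (n + 2)" if "v \<in> {1..n+2}" "v \<noteq> n + 2" for v
        using eq [of "v - 1"] that by auto
      ultimately have "x v \<noteq> 0" if "v \<in> {1..n+2}" for v
        using that by (metis divide_eq_0_iff of_nat_eq_0_iff add_eq_0_iff_both_eq_0 zero_neq_numeral zero_neq_one)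
      then show False
        using x by (auto simp: topspace_realization_simplex_boundary)
    qed
    then show ?thesis
      by (auto simp: r_def intro!: sum_pos2)
  qed
  have cont_y: "continuous_map ?X euclideanreal (\<lambda>x. y x i)" for i
    by (cases "i \<le> n") (auto simp: y_def intro!: continuous_map_diff continuous_map_coordinate_realization)
  have cont_r: "continuous_map ?X euclideanreal r"
    unfolding r_def
    by (intro continuous_map_sqrt continuous_map_sum continuous_map_real_pow cont_y) auto
  have cont_b: "continuous_map ?X (nsphere n) ?b"
    unfolding nsphere continuous_map_in_subtopology continuous_map_componentwise_UNIV b
  proof (intro conjI allI funcsetI CollectI impI)
    show "continuous_map ?X euclideanreal (\<lambda>x. y x k / r x)" for k
      by (intro continuous_map_real_divide cont_y cont_r) (use r_pos in force)
    fix x assume x: "x \<in> topspace ?X"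
    have "(\<Sum>i\<le>n. (y x i / r x)\<^sup>2) = (r x)\<^sup>2 / (r x)\<^sup>2"
      by (simp add: r_def power_divide sum_nonneg flip: sum_divide_distrib)
    then show "(\<Sum>i\<le>n. (y x i / r x)\<^sup>2) = 1"
      using r_pos [OF x] by simp
  qed (auto simp: y_def)
  have cont_w: "continuous_map (nsphere n) euclideanreal (\<lambda>u. w u v)" for v
    by (cases "v = n + 2")
       (auto simp: w_def intro!: continuous_map_minus continuous_map_sum continuous_map_nsphere_projection)
  have cont_m: "continuous_map (nsphere n) euclideanreal m"
    unfolding m_def by (intro continuous_map_minus continuous_map_Min I cont_w)
  have s_in: "s u \<in> topspace ?X" if u: "u \<in> topspace (nsphere n)" for u
  proof -
    have "0 \<le> s u v" for v
    proof (cases "v \<in> I")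
      case True
      then have "- m u \<le> w u v"
        using I unfolding m_def minus_minus by simp
      then show ?thesis
        using m_pos [OF u] by (simp add: s_def field_simps)
    qed (simp add: s_def)
    moreover have "\<exists>v\<in>I. s u v = 0"
    proof -
      have "Min (w u ` I) \<in> w u ` I"
        using I by (intro Min_in) auto
      then obtain v where "v \<in> I" "w u v = - m u"
        unfolding m_def minus_minus by (metis imageE)
      then have "s u v = 0"
        using m_pos [OF u] by (simp add: s_def)
      with \<open>v \<in> I\<close> show ?thesis
        by blast
    qed
    moreover have "(\<Sum>v\<in>I. s u v) = 1"
    proof -
      have "(\<Sum>v\<in>I. s u v) = (\<Sum>v\<in>I. 1 + w u v / m u) / real (n + 2)"
        by (simp add: s_def sum_divide_distrib)
      also have "(\<Sum>v\<in>I. 1 + w u v / m u) = real (card I)"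
        by (simp add: sum.distrib sum_w flip: sum_divide_distrib)
      finally show ?thesis
        by (simp add: I_def)
    qed
    ultimately show ?thesis
      by (simp add: topspace_realization_simplex_boundary I_def s_def)
  qed
  have cont_s: "continuous_map (nsphere n) ?X s"
    unfolding realization_def continuous_map_in_subtopology continuous_map_componentwise_UNIV
  proof (intro conjI allI funcsetI)
    show "continuous_map (nsphere n) euclideanreal (\<lambda>u. s u v)" for v
    proof (cases "v \<in> I")
      case True
      have "continuous_map (nsphere n) euclideanreal (\<lambda>u. (1 + w u v / m u) / real (n + 2))"
        by (intro continuous_map_real_divide continuous_map_add cont_w cont_m
              continuous_map_const [THEN iffD2]) (use m_pos in force)+
      with True show ?thesis
        by (simp add: s_def)
    qed (simp add: s_def)
  qed (use s_in in \<open>simp add: topspace_realization\<close>)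
  have bs: "?b (s u) = u" if u: "u \<in> topspace (nsphere n)" for u
  proof -
    have ys: "y (s u) i = u i / (m u * real (n + 2))" if "i \<le> n" for i
      using that by (simp add: y_def s_def I_def w_def add_divide_distrib)
    have "(\<Sum>j\<le>n. (y (s u) j)\<^sup>2) = (\<Sum>j\<le>n. (u j)\<^sup>2) / (m u * real (n + 2))\<^sup>2"
      by (simp add: ys power_divide sum_divide_distrib)
    also have "(\<Sum>j\<le>n. (u j)\<^sup>2) = 1"
      using u by (simp add: nsphere)
    finally have "r (s u) = 1 / (m u * real (n + 2))"
      using m_pos [OF u] by (simp add: r_def real_sqrt_divide)
    then have "?b (s u) i = u i" if "i \<le> n" for i
      using m_pos [OF u] that by (simp add: b ys)
    moreover have "?b (s u) i = u i" if "\<not> i \<le> n" for i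
      using u that by (simp add: b y_def nsphere)
    ultimately have "?b (s u) i = u i" for i
      by blast
    then show ?thesis
      by blast
  qed
  have sb: "s (?b x) = x" if x: "x \<in> topspace ?X" for x
  proof -
    let ?c = "1 / real (n + 2)"
    have nn: "\<And>v. 0 \<le> x v" and out: "\<And>v. v \<notin> I \<Longrightarrow> x v = 0" and "\<exists>v\<in>I. x v = 0"
      and sum1: "(\<Sum>v=1..n+2. x v) = 1"
      using x by (auto simp: topspace_realization_simplex_boundary I_def)
    then obtain v0 where v0: "v0 \<in> I" "x v0 = 0"
      by blast
    \<comment> \<open>The deviations of the n+2 coordinates from 1/(n+2) sum to 0, so
      \<open>w\<close> recovers the forgotten one.\<close>
    have wb: "w (?b x) v = (x v - ?c) / r x" if "v \<in> I" for v
    proof (cases "v = n + 2")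
      case True
      have "(\<Sum>i\<le>n. y x i) = (\<Sum>i\<le>n. x (Suc i)) - real (n + 1) * ?c"
        by (simp add: y_def sum_subtractf)
      also have "(\<Sum>i\<le>n. x (Suc i)) = 1 - x (n + 2)"
        using sum1 unfolding sum_shift_split by simp
      finally have "(\<Sum>i\<le>n. y x i) = ?c - x (n + 2)"
        by (simp add: field_simps)
      with True show ?thesis
        by (simp add: w_def b minus_divide_left flip: sum_divide_distrib)
    next
      case False
      with that show ?thesis
        by (auto simp: w_def b y_def I_def)
    qed
    \<comment> \<open>The least entry belongs to a vanishing coordinate of \<open>x\<close>, such as
      the one at \<open>v0\<close>.\<close>
    have "Min (w (?b x) ` I) = - ?c / r x"
    proof (rule Min_eqI)
      show "- ?c / r x \<in> w (?b x) ` I"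
        using v0 wb by (intro image_eqI [of _ _ v0]) auto
      show "- ?c / r x \<le> a" if a: "a \<in> w (?b x) ` I" for a
      proof -
        obtain v where v: "v \<in> I" "a = (x v - ?c) / r x"
          using a wb by auto
        have "- ?c \<le> x v - ?c"
          using nn [of v] by linarith
        then show ?thesis
          unfolding v(2) using r_pos [OF x] by (intro divide_right_mono) auto
      qed
    qed (use I in auto)
    then have mb: "m (?b x) = ?c / r x"
      by (simp add: m_def)
    have "s (?b x) v = x v" for v
    proof (cases "v \<in> I")
      case True
      have "w (?b x) v / m (?b x) = (x v - ?c) / ?c"
        using r_pos [OF x] by (simp only: wb [OF True] mb) simp
      also have "\<dots> = x v * real (n + 2) - 1"
        by (simp add: left_diff_distrib)
      finally show ?thesis
        using True by (simp add: s_def)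
    next
      case False
      then show ?thesis
        by (simp add: s_def out)
    qed
    then show ?thesis
      by blast
  qed
  have "homeomorphic_maps ?X (nsphere n) ?b s"
    by (simp add: homeomorphic_maps_def cont_b cont_s bs sb)
  then show ?thesis
    using homeomorphic_map_maps by blast
qed

section \<open>The fundamental cycle and the degree\<close>

text \<open>The shift sends vertex \<open>j\<close> of the standard simplex to the colour
  \<open>Suc j\<close>. The full simplex is not contained in the realization of
  \<open>simplex_boundary n\<close>; only its boundary is, and there the cycle need not
  bound.\<close>

definition simplex_boundary_cycle :: "nat \<Rightarrow> (nat \<Rightarrow> real) chain" where
  "simplex_boundary_cycle n =
     chain_boundary (Suc n) (frag_of (oriented_simplex (Suc n) (\<lambda>j. vertex_point (Suc j))))"

lemma singular_simplex_oriented_simplex: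
  "singular_simplex p (powertop_real UNIV) (oriented_simplex p l)"
  using simplicial_simplex [of p UNIV "oriented_simplex p l"]
  by (auto simp: simplicial_simplex_def)

text \<open>Shifting coordinates by one carries the realization into
  \<open>boundary_of_standard_simplex (Suc n)\<close> and the cycle to the boundary of the
  fundamental simplex, so a bounding chain could be carried over as well.\<close>

lemma simplex_boundary_cycle_not_boundary:
  "\<not> singular_relboundary n (realization (simplex_boundary n)) {} (simplex_boundary_cycle n)"
proof
  assume "singular_relboundary n (realization (simplex_boundary n)) {} (simplex_boundary_cycle n)"
  let ?s = "\<lambda>(x::nat \<Rightarrow> real) i. x (Suc i)"
  let ?Y = "subtopology (powertop_real UNIV) (boundary_of_standard_simplex (Suc n))"
  have "?s x \<in> boundary_of_standard_simplex (Suc n)"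
    if "x \<in> topspace (realization (simplex_boundary n))" for x
  proof -
    have nn: "\<And>v. 0 \<le> x v" and out: "\<And>v. v \<notin> {1..n+2} \<Longrightarrow> x v = 0" and ex: "\<exists>v\<in>{1..n+2}. x v = 0"
      and sum1: "(\<Sum>v=1..n+2. x v) = 1"
      using that by (auto simp: topspace_realization_simplex_boundary)
    have sum1': "(\<Sum>i\<le>Suc n. x (Suc i)) = 1"
      using sum1 unfolding sum_shift_split by simp
    have "x v \<le> 1" for v
    proof (cases "v \<in> {1..n+2}")
      case True
      then show ?thesis
        using member_le_sum [of v "{1..n+2}" x] nn sum1 by auto
    qed (simp add: out)
    moreover from ex obtain v where "v \<in> {1..n+2}" "x v = 0"
      by blast
    then have "\<exists>i\<le>Suc n. x (Suc i) = 0"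
      by (intro exI [of _ "v - 1"]) auto
    ultimately show ?thesis
      using nn out sum1' by (auto simp: boundary_of_standard_simplex_def standard_simplex_def)
  qed
  then have "continuous_map (realization (simplex_boundary n)) ?Y ?s"
    unfolding continuous_map_in_subtopology continuous_map_componentwise_UNIV
    by (auto intro: continuous_map_coordinate_realization)
  then have "singular_relboundary n ?Y {} (chain_map n ?s (simplex_boundary_cycle n))"
    using \<open>singular_relboundary n (realization _) {} _\<close>
    by (intro singular_relboundary_chain_map) auto
  moreover have "chain_map n ?s (simplex_boundary_cycle n) =
      chain_boundary (Suc n) (fundamental_simplex (Suc n))"
  proof -
    have "simplex_map (Suc n) ?s (oriented_simplex (Suc n) (\<lambda>j. vertex_point (Suc j))) x i =
          restrict id (standard_simplex (Suc n)) x i" for x i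
      by (auto simp: simplex_map_def oriented_simplex_def standard_simplex_def if_distrib [of "\<lambda>u. u * _"] cong: if_cong)
    then have "simplex_map (Suc n) ?s (oriented_simplex (Suc n) (\<lambda>j. vertex_point (Suc j))) =
               restrict id (standard_simplex (Suc n))"
      by blast
    then show ?thesis
      using chain_boundary_chain_map [of "Suc n" "powertop_real UNIV"
          "frag_of (oriented_simplex (Suc n) (\<lambda>j. vertex_point (Suc j)))" ?s]
      by (simp add: simplex_boundary_cycle_def fundamental_simplex_def singular_chain_of
          singular_simplex_oriented_simplex)
  qed
  ultimately show False
    using boundary_of_fundamental_simplex_not_boundary by simp
qed

text \<open>Homology groups are written multiplicatively and chains additively. Taking classes is a
  homomorphism on the group of cycles, and in that group a power is an integer multiple of
  chains.\<close>

lemma int_pow_homology_class: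
  assumes "singular_relcycle p X S c"
  shows "homologous_rel_set p X S c [^]\<^bsub>relative_homology_group (int p) X S\<^esub> (k::int) =
         homologous_rel_set p X S (frag_cmul k c)"
proof -
  let ?R = "relcycle_group p X S"
  interpret N: normal "singular_relboundary_set p X S" ?R
    by (rule normal_subgroup_singular_relboundary_relcycle)
  have c: "c \<in> carrier ?R"
    using assms by simp
  have hom: "homologous_rel_set p X S \<in> hom ?R (relative_homology_group (int p) X S)"
    using N.r_coset_hom_Mod
    by (simp add: right_coset_singular_relboundary nontrivial_relative_homology_group)
  have "c [^]\<^bsub>?R\<^esub> k = frag_cmul k c"
  proof -
    interpret C: group "chain_group p X"
      by simp
    have sub: "subgroup (singular_relcycle_set p X S) (chain_group p X)"
      by (rule subgroup_singular_relcycle)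
    have "c [^]\<^bsub>?R\<^esub> k = c [^]\<^bsub>chain_group p X\<^esub> k"
      using c by (simp add: relcycle_group_def C.int_pow_subgroup_generated)
    also have "\<dots> = frag_cmul k c"
      using assms by (simp add: chain_group_def singular_relcycle singular_chain_def)
    finally show ?thesis .
  qed
  then show ?thesis
    using hom_int_pow [OF hom c, of k] by simp
qed

text \<open>Take for \<open>h\<close> the inverse of \<open>b \<circ> \<Psi>\<close>. Then
  \<open>b \<circ> f \<circ> h\<close> sends the image \<open>c\<close> of \<open>z\<close> to
  \<open>d\<close> times the image \<open>a\<close> of \<open>z0\<close>, and \<open>c\<close> is
  homologous to \<open>a\<close>. So the nonzero class of \<open>a\<close> is multiplied by
  \<open>d\<close>, which fixes the degree. Choosing \<open>h\<close> through \<open>\<Psi>\<close>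
  also settles the orientation, hence the sign.\<close>

proposition Brouwer_degree2_conjugate_eq:
  assumes n: "1 \<le> n"
    and b: "homeomorphic_map Y (nsphere n) b"
    and \<Psi>: "homeomorphic_map X Y \<Psi>"
    and f: "continuous_map X Y f"
    and z: "singular_relcycle n X {} z"
    and \<Psi>z: "homologous_rel n Y {} (chain_map n \<Psi> z) z0"
    and fz: "chain_map n f z = frag_cmul d z0"
    and z0: "\<not> singular_relboundary n Y {} z0"
  obtains h where "homeomorphic_map (nsphere n) X h" "Brouwer_degree2 n (b \<circ> f \<circ> h) = d"
proof -
  have "homeomorphic_map X (nsphere n) (b \<circ> \<Psi>)"
    using b \<Psi> homeomorphic_map_compose by blast
  then obtain h where h: "homeomorphic_maps X (nsphere n) (b \<circ> \<Psi>) h"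
    using homeomorphic_map_maps by blast
  obtain b' where b': "homeomorphic_maps Y (nsphere n) b b'"
    using b homeomorphic_map_maps by blast
  have cont: "continuous_map Y (nsphere n) b" "continuous_map (nsphere n) Y b'" "continuous_map X Y \<Psi>"
    "continuous_map X (nsphere n) (b \<circ> \<Psi>)" "continuous_map (nsphere n) X h"
    using b' h \<Psi> homeomorphic_imp_continuous_map by (auto simp: homeomorphic_maps_def)
  have h_inv: "h ((b \<circ> \<Psi>) x) = x" if "x \<in> topspace X" for x
    using h that by (simp add: homeomorphic_maps_def)
  have b'_inv: "b' (b x) = x" if "x \<in> topspace Y" for x
    using b' that by (simp add: homeomorphic_maps_def)
  let ?S = "nsphere n"
  let ?G = "homology_group (int n) ?S"
  \<comment> \<open>Brouwer degrees are defined by reduced homology, which agrees with ordinary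
    homology in positive dimension.\<close>
  have G: "reduced_homology_group (int n) ?S = ?G"
    using n by (simp add: un_reduced_homology_group)
  define a where "a = chain_map n b z0"
  define c where "c = chain_map n (b \<circ> \<Psi>) z"
  have z0_cyc: "singular_relcycle n Y {} z0"
  proof -
    have "singular_relcycle n Y {} (chain_map n \<Psi> z)"
      using z cont by (intro singular_relcycle_chain_map) auto
    with \<Psi>z show ?thesis
      using homologous_rel_singular_relcycle by blast
  qed
  have c_cyc: "singular_relcycle n ?S {} c"
    unfolding c_def using z cont by (intro singular_relcycle_chain_map) auto
  have a_cyc: "singular_relcycle n ?S {} a"
    unfolding a_def using z0_cyc cont by (intro singular_relcycle_chain_map) auto
  have ca: "homologous_rel n ?S {} c a"
  proof -
    have "singular_relboundary n ?S {} (chain_map n b (chain_map n \<Psi> z - z0))"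
      using \<Psi>z cont unfolding homologous_rel_def by (intro singular_relboundary_chain_map) auto
    then show ?thesis
      by (simp add: homologous_rel_def c_def a_def chain_map_compose chain_map_diff)
  qed
  have a_nonzero: "\<not> singular_relboundary n ?S {} a"
  proof
    assume "singular_relboundary n ?S {} a"
    then have "singular_relboundary n Y {} (chain_map n b' a)"
      using cont by (intro singular_relboundary_chain_map) auto
    moreover have "chain_map n b' a = z0"
      unfolding a_def
      using chain_map_id_gen [of n Y z0 "b' \<circ> b"] z0_cyc b'_inv
      by (simp add: singular_relcycle chain_map_compose)
    ultimately show False
      using z0 by simp
  qed
  have bfh: "continuous_map ?S ?S (b \<circ> f \<circ> h)"
    using cont f by (intro continuous_map_compose) auto
  have hc: "chain_map n h c = z"
    unfolding c_def
    using chain_map_id_gen [of n X z "h \<circ> (b \<circ> \<Psi>)"] z h_inv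
    by (simp add: singular_relcycle chain_map_compose)
  have "chain_map n (b \<circ> f \<circ> h) c = frag_cmul d a"
    by (simp add: chain_map_compose hc fz a_def)
  then have "hom_induced n ?S {} ?S {} (b \<circ> f \<circ> h) (homologous_rel_set n ?S {} c) =
        homologous_rel_set n ?S {} (frag_cmul d a)"
    using hom_induced_chain_map [OF bfh _ c_cyc, of "{}"] by simp
  also have "\<dots> = homologous_rel_set n ?S {} a [^]\<^bsub>?G\<^esub> d"
    by (simp add: int_pow_homology_class [OF a_cyc])
  finally have eq: "hom_induced n ?S {} ?S {} (b \<circ> f \<circ> h) (homologous_rel_set n ?S {} a) =
      homologous_rel_set n ?S {} a [^]\<^bsub>?G\<^esub> d"
    using ca by (simp add: homologous_rel_set_eq [THEN iffD2])
  have "homologous_rel_set n ?S {} a \<in> carrier ?G"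
    using a_cyc by (simp add: carrier_relative_homology_group)
  moreover have "homologous_rel_set n ?S {} a \<noteq> \<one>\<^bsub>?G\<^esub>"
    using a_nonzero by (simp add: homologous_rel_set_eq_relboundary)
  ultimately have "Brouwer_degree2 n (b \<circ> f \<circ> h) = d"
    using Brouwer_degree2_iff [OF bfh, of "homologous_rel_set n ?S {} a" d] eq unfolding G by blast
  moreover have "homeomorphic_map ?S X h"
    using h homeomorphic_maps_map homeomorphic_maps_sym by blast
  ultimately show thesis
    using that by blast
qed


subsection \<open>Stellar subdivision of a facet\<close>

definition complex_from_facets :: "nat set set \<Rightarrow> nat set set" where
  "complex_from_facets \<F> = {\<sigma>. \<sigma> \<noteq> {} \<and> (\<exists>\<rho>\<in>\<F>. \<sigma> \<subseteq> \<rho>)}"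

lemma vertices_complex_from_facets: "vertices (complex_from_facets \<F>) = \<Union>\<F>"
proof -
  have "u \<in> \<Union>(complex_from_facets \<F>)" if "u \<in> \<rho>" "\<rho> \<in> \<F>" for u \<rho>
    using that by (intro UnionI [of "{u}"]) (auto simp: complex_from_facets_def)
  then show ?thesis
    by (auto simp: vertices_def complex_from_facets_def)
qed

text \<open>The sum may run over any finite superset of the vertices, so that a complex and its
  subdivision are compared over one index set. The support is nonempty because the sum is 1.\<close>

lemma in_realization_complex_from_facets:
  assumes A: "finite A" "\<Union>\<F> \<subseteq> A"
  shows "x \<in> topspace (realization (complex_from_facets \<F>)) \<longleftrightarrow>
     (\<forall>u. 0 \<le> x u) \<and> (\<exists>\<rho>\<in>\<F>. \<forall>u. u \<notin> \<rho> \<longrightarrow> x u = 0) \<and> (\<Sum>u\<in>A. x u) = 1"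
    (is "?lhs \<longleftrightarrow> ?rhs")
proof
  assume ?lhs
  then have nn: "\<forall>u. 0 \<le> x u" and supp: "{u. x u \<noteq> 0} \<in> complex_from_facets \<F>"
    and "(\<Sum>u\<in>\<Union>\<F>. x u) = 1"
    by (auto simp: topspace_realization vertices_complex_from_facets)
  from supp obtain \<rho> where \<rho>: "\<rho> \<in> \<F>" "{u. x u \<noteq> 0} \<subseteq> \<rho>"
    by (auto simp: complex_from_facets_def)
  then have "(\<Sum>u\<in>\<Union>\<F>. x u) = (\<Sum>u\<in>A. x u)"
    using A by (intro sum.mono_neutral_left) auto
  with \<open>(\<Sum>u\<in>\<Union>\<F>. x u) = 1\<close> nn \<rho> show ?rhs
    by auto
next
  assume ?rhs
  then obtain \<rho> where nn: "\<forall>u. 0 \<le> x u" and \<rho>: "\<rho> \<in> \<F>" "\<forall>u. u \<notin> \<rho> \<longrightarrow> x u = 0"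
    and sum1: "(\<Sum>u\<in>A. x u) = 1"
    by blast
  have "(\<Sum>u\<in>\<Union>\<F>. x u) = (\<Sum>u\<in>A. x u)"
    using A \<rho> by (intro sum.mono_neutral_left) auto
  moreover have "{u. x u \<noteq> 0} \<noteq> {}"
  proof
    assume "{u. x u \<noteq> 0} = {}"
    then have "(\<Sum>u\<in>A. x u) = 0"
      by (intro sum.neutral) auto
    with sum1 show False
      by simp
  qed
  moreover have "{u. x u \<noteq> 0} \<subseteq> \<rho>"
    using \<rho> by auto
  ultimately have "{u. x u \<noteq> 0} \<in> complex_from_facets \<F>" "(\<Sum>u\<in>\<Union>\<F>. x u) = 1"
    using \<rho> sum1 by (auto simp: complex_from_facets_def)
  with nn show ?lhs
    by (simp add: topspace_realization vertices_complex_from_facets)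
qed

definition stellar_facets :: "nat set set \<Rightarrow> nat set \<Rightarrow> nat \<Rightarrow> nat set set" where
  "stellar_facets \<F> \<sigma> v = (\<F> - {\<sigma>}) \<union> (\<lambda>u. insert v (\<sigma> - {u})) ` \<sigma>"

text \<open>The affine map that moves the new vertex \<open>v\<close> to the barycentre of \<open>\<sigma>\<close>.\<close>

definition stellar_map :: "nat set \<Rightarrow> nat \<Rightarrow> (nat \<Rightarrow> real) \<Rightarrow> nat \<Rightarrow> real" where
  "stellar_map \<sigma> v y u = (if u = v then 0 else if u \<in> \<sigma> then y u + y v / real (card \<sigma>) else y u)"

text \<open>The weight of \<open>v\<close> is shared equally among the vertices of
  \<open>\<sigma>\<close>, which preserves the total. The support may be all of
  \<open>insert v \<rho>\<close>: thus the lemma covers the points of the subdivision and also those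
  of the full simplex on \<open>insert v \<sigma>\<close>.\<close>

lemma stellar_map_in_realization:
  assumes B: "finite (\<Union>\<F>)" and \<sigma>: "\<sigma> \<in> \<F>" "\<sigma> \<noteq> {}" and v: "v \<notin> \<Union>\<F>"
    and y: "\<And>u. 0 \<le> y u" "(\<Sum>u\<in>insert v (\<Union>\<F>). y u) = 1"
    and \<rho>: "\<rho> \<in> \<F>" "\<And>u. u \<notin> insert v \<rho> \<Longrightarrow> y u = 0" "y v = 0 \<or> \<rho> = \<sigma>"
  shows "stellar_map \<sigma> v y \<in> topspace (realization (complex_from_facets \<F>))"
proof -
  have \<sigma>B: "\<sigma> \<subseteq> \<Union>\<F>" and fin: "finite \<sigma>" and c: "card \<sigma> \<noteq> 0"
    using \<sigma> B by (auto intro: finite_subset dest: finite_subset [OF Union_upper])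
  have eq: "stellar_map \<sigma> v y u = (if u = v then 0 else y u) + (if u \<in> \<sigma> then y v / real (card \<sigma>) else 0)" for u
    using v \<sigma> by (auto simp: stellar_map_def)
  have "(\<Sum>u\<in>\<Union>\<F>. stellar_map \<sigma> v y u) =
        (\<Sum>u\<in>\<Union>\<F>. y u) + (\<Sum>u\<in>\<Union>\<F>. if u \<in> \<sigma> then y v / real (card \<sigma>) else 0)"
    unfolding sum.distrib [symmetric] by (rule sum.cong) (use v in \<open>auto simp: eq\<close>)
  also have "(\<Sum>u\<in>\<Union>\<F>. if u \<in> \<sigma> then y v / real (card \<sigma>) else 0) = y v"
    using B \<sigma>B c by (simp add: sum.If_cases Int_absorb1)
  also have "(\<Sum>u\<in>\<Union>\<F>. y u) + y v = 1"
    using y B v by simp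
  finally have "(\<Sum>u\<in>\<Union>\<F>. stellar_map \<sigma> v y u) = 1" .
  moreover have "0 \<le> stellar_map \<sigma> v y u" for u
    using y by (simp add: stellar_map_def)
  moreover have "stellar_map \<sigma> v y u = 0" if "u \<notin> \<rho>" for u
    using \<rho>(2) [of u] \<rho>(3) that by (auto simp: stellar_map_def)
  ultimately show ?thesis
    unfolding in_realization_complex_from_facets [OF B order_refl] using \<rho>(1) by blast
qed

lemma stellar_map_ident:
  assumes "x v = 0"
  shows "stellar_map \<sigma> v x = x"
  using assms by (auto simp: stellar_map_def)

lemma continuous_map_stellar_map:
  "continuous_map (powertop_real UNIV) (powertop_real UNIV) (stellar_map \<sigma> v)"
  unfolding continuous_map_componentwise_UNIV
proof
  fix u
  have proj: "continuous_map (powertop_real UNIV) euclideanreal (\<lambda>y. y i)" for i :: nat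
    by (rule continuous_map_product_projection) simp
  have "continuous_map (powertop_real UNIV) euclideanreal (\<lambda>y. y v * (1 / real (card \<sigma>)))"
    by (intro continuous_map_real_mult proj continuous_map_const [THEN iffD2]) auto
  then show "continuous_map (powertop_real UNIV) euclideanreal (\<lambda>y. stellar_map \<sigma> v y u)"
    by (cases "u = v"; cases "u \<in> \<sigma>") (auto simp: stellar_map_def intro!: continuous_map_add proj)
qed

text \<open>The inverse \<open>\<phi>\<close> takes the least weight \<open>\<mu> x\<close> away
  from every vertex of \<open>\<sigma>\<close> and gives the total to \<open>v\<close>. By
  maximality any other facet misses a vertex of \<open>\<sigma>\<close>; there the least weight is 0
  and \<open>\<phi>\<close> is the identity.\<close>

proposition homeomorphic_map_stellar_map:
  assumes B: "finite (\<Union>\<F>)" and \<sigma>: "\<sigma> \<in> \<F>" "\<sigma> \<noteq> {}" and v: "v \<notin> \<Union>\<F>"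
    and maximal: "\<And>\<rho>. \<rho> \<in> \<F> \<Longrightarrow> \<sigma> \<subseteq> \<rho> \<Longrightarrow> \<rho> = \<sigma>"
  shows "homeomorphic_map (realization (complex_from_facets (stellar_facets \<F> \<sigma> v)))
           (realization (complex_from_facets \<F>)) (stellar_map \<sigma> v)"
proof -
  let ?\<F>' = "stellar_facets \<F> \<sigma> v"
  let ?X = "realization (complex_from_facets \<F>)"
  let ?X' = "realization (complex_from_facets ?\<F>')"
  let ?A = "insert v (\<Union>\<F>)"
  let ?\<psi> = "stellar_map \<sigma> v"
  define \<mu> where "\<mu> = (\<lambda>x::nat\<Rightarrow>real. Min (x ` \<sigma>))"
  define \<phi> where "\<phi> = (\<lambda>x u. if u = v then real (card \<sigma>) * \<mu> x else if u \<in> \<sigma> then x u - \<mu> x else x u)"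
  have \<sigma>B: "\<sigma> \<subseteq> \<Union>\<F>" and fin: "finite \<sigma>" and c: "card \<sigma> \<noteq> 0" and v\<sigma>: "v \<notin> \<sigma>"
    using \<sigma> B v by (auto intro: finite_subset dest: finite_subset [OF Union_upper])
  have A: "finite ?A" "\<Union>\<F> \<subseteq> ?A" "\<Union>?\<F>' \<subseteq> ?A"
    using B \<sigma> by (auto simp: stellar_facets_def)
  note X = in_realization_complex_from_facets [OF A(1,2)]
  note X' = in_realization_complex_from_facets [OF A(1,3)]
  have \<mu>_le: "\<mu> x \<le> x u" if "u \<in> \<sigma>" for x u
    using that fin by (simp add: \<mu>_def)
  have \<mu>_ex: "\<exists>u\<in>\<sigma>. \<mu> x = x u" for x
  proof -
    have "\<mu> x \<in> x ` \<sigma>"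
      unfolding \<mu>_def using fin \<sigma>(2) by (intro Min_in) auto
    then show ?thesis
      by auto
  qed
  have \<psi>_in: "?\<psi> y \<in> topspace ?X" if y: "y \<in> topspace ?X'" for y
  proof -
    obtain \<rho> where nn: "\<And>u. 0 \<le> y u" and \<rho>: "\<rho> \<in> ?\<F>'" "\<And>u. u \<notin> \<rho> \<Longrightarrow> y u = 0"
      and sum1: "(\<Sum>u\<in>?A. y u) = 1"
      using y unfolding X' by blast
    show ?thesis
    proof (cases "\<rho> \<in> \<F>")
      case True
      with v have "v \<notin> \<rho>"
        by blast
      with \<rho> True show ?thesis
        by (intro stellar_map_in_realization [OF B \<sigma> v nn sum1 True]) auto
    next
      case False
      with \<rho> have "\<rho> \<subseteq> insert v \<sigma>"
        by (auto simp: stellar_facets_def)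
      with \<rho> show ?thesis
        by (intro stellar_map_in_realization [OF B \<sigma> v nn sum1 \<sigma>(1)]) auto
    qed
  qed
  have \<phi>_in: "\<phi> x \<in> topspace ?X'" if x: "x \<in> topspace ?X" for x
  proof -
    obtain \<rho> where nn: "\<And>u. 0 \<le> x u" and \<rho>: "\<rho> \<in> \<F>" "\<And>u. u \<notin> \<rho> \<Longrightarrow> x u = 0"
      and sum1: "(\<Sum>u\<in>?A. x u) = 1"
      using x unfolding X by blast
    have xv: "x v = 0"
      using \<rho> v by blast
    obtain u0 where u0: "u0 \<in> \<sigma>" "\<mu> x = x u0"
      using \<mu>_ex by blast
    have nn': "0 \<le> \<phi> x u" for u
      using nn u0 \<mu>_le [of u x] by (simp add: \<phi>_def)
    have "(\<Sum>u\<in>\<Union>\<F>. \<phi> x u) = (\<Sum>u\<in>\<Union>\<F>. x u) - (\<Sum>u\<in>\<Union>\<F>. if u \<in> \<sigma> then \<mu> x else 0)"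
      unfolding sum_subtractf [symmetric] by (rule sum.cong) (use v in \<open>auto simp: \<phi>_def\<close>)
    also have "(\<Sum>u\<in>\<Union>\<F>. if u \<in> \<sigma> then \<mu> x else 0) = real (card \<sigma>) * \<mu> x"
      using B \<sigma>B by (simp add: sum.If_cases Int_absorb1)
    finally have sum1': "(\<Sum>u\<in>?A. \<phi> x u) = 1"
      using sum1 B v xv by (simp add: \<phi>_def)
    have "\<exists>\<rho>\<in>?\<F>'. \<forall>u. u \<notin> \<rho> \<longrightarrow> \<phi> x u = 0"
    proof (cases "\<rho> = \<sigma>")
      \<comment> \<open>Subtracting the minimum kills the coordinate at \<open>u0\<close>, so the
        image lies in the new facet without \<open>u0\<close>.\<close>
      case True
      then have "\<phi> x u = 0" if "u \<notin> insert v (\<sigma> - {u0})" for u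
        using that u0 \<rho> by (auto simp: \<phi>_def)
      moreover have "insert v (\<sigma> - {u0}) \<in> ?\<F>'"
        using u0 by (auto simp: stellar_facets_def)
      ultimately show ?thesis
        by blast
    next
      case False
      with maximal \<rho> obtain u1 where "u1 \<in> \<sigma>" "u1 \<notin> \<rho>"
        by blast
      with \<rho> \<mu>_le [of u1 x] nn [of u0] u0 have "\<mu> x = 0"
        by (metis order_antisym)
      then have "\<phi> x u = 0" if "u \<notin> \<rho>" for u
        using that \<rho> by (simp add: \<phi>_def)
      moreover have "\<rho> \<in> ?\<F>'"
        using False \<rho> by (simp add: stellar_facets_def)
      ultimately show ?thesis
        by blast
    qed
    with nn' sum1' show ?thesis
      unfolding X' by blast
  qed
  have cont_\<mu>: "continuous_map ?X euclideanreal \<mu>"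
    unfolding \<mu>_def by (intro continuous_map_Min fin \<sigma>(2) continuous_map_coordinate_realization)
  have cont_\<phi>: "continuous_map ?X ?X' \<phi>"
    unfolding realization_def [of "complex_from_facets ?\<F>'"] continuous_map_in_subtopology
      continuous_map_componentwise_UNIV
  proof (intro conjI allI funcsetI)
    fix u
    have "continuous_map ?X euclideanreal (\<lambda>x. real (card \<sigma>) * \<mu> x)"
      by (intro continuous_map_real_mult cont_\<mu> continuous_map_const [THEN iffD2]) auto
    then show "continuous_map ?X euclideanreal (\<lambda>x. \<phi> x u)"
      by (cases "u = v"; cases "u \<in> \<sigma>")
         (auto simp: \<phi>_def intro!: continuous_map_diff continuous_map_coordinate_realization cont_\<mu>)
  qed (use \<phi>_in in \<open>simp add: topspace_realization\<close>)
  have cont_\<psi>: "continuous_map ?X' ?X ?\<psi>"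
    unfolding realization_def [of "complex_from_facets \<F>"] continuous_map_in_subtopology
  proof (intro conjI funcsetI)
    show "continuous_map ?X' (powertop_real UNIV) ?\<psi>"
      unfolding realization_def by (intro continuous_map_from_subtopology continuous_map_stellar_map)
  qed (use \<psi>_in in \<open>simp add: topspace_realization\<close>)
  have \<psi>\<phi>: "?\<psi> (\<phi> x) = x" if x: "x \<in> topspace ?X" for x
  proof -
    have "x v = 0"
      using x v unfolding X by blast
    then show ?thesis
      using c v\<sigma> by (auto simp: stellar_map_def \<phi>_def)
  qed
  have \<phi>\<psi>: "\<phi> (?\<psi> y) = y" if y: "y \<in> topspace ?X'" for y
  proof -
    obtain \<rho> where nn: "\<And>u. 0 \<le> y u" and \<rho>: "\<rho> \<in> ?\<F>'" "\<And>u. u \<notin> \<rho> \<Longrightarrow> y u = 0"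
      using y unfolding X' by blast
    \<comment> \<open>No facet of the subdivision contains \<open>\<sigma>\<close>. Hence the least
      weight of \<open>?\<psi> y\<close> on \<open>\<sigma>\<close> is precisely the share received
      from \<open>v\<close>, and \<open>\<phi>\<close> gives it back.\<close>
    have "\<exists>u\<in>\<sigma>. y u = 0"
    proof (cases "\<rho> \<in> \<F> - {\<sigma>}")
      case True
      with maximal [of \<rho>] obtain u where "u \<in> \<sigma>" "u \<notin> \<rho>"
        by blast
      with \<rho>(2) show ?thesis
        by auto
    next
      case False
      with \<rho>(1) have "\<rho> \<in> (\<lambda>u. insert v (\<sigma> - {u})) ` \<sigma>"
        unfolding stellar_facets_def by blast
      then obtain u where u: "u \<in> \<sigma>" "\<rho> = insert v (\<sigma> - {u})"
        by blast
      with v\<sigma> have "u \<notin> \<rho>"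
        by auto
      with \<rho>(2) u(1) show ?thesis
        by auto
    qed
    then obtain u1 where u1: "u1 \<in> \<sigma>" "y u1 = 0"
      by blast
    have "\<mu> (?\<psi> y) = y v / real (card \<sigma>)"
      unfolding \<mu>_def
    proof (rule Min_eqI)
      show "y v / real (card \<sigma>) \<in> ?\<psi> y ` \<sigma>"
        using u1 v\<sigma> by (intro image_eqI [of _ _ u1]) (auto simp: stellar_map_def)
      show "y v / real (card \<sigma>) \<le> a" if "a \<in> ?\<psi> y ` \<sigma>" for a
        using that nn v\<sigma> by (auto simp: stellar_map_def)
    qed (use fin in auto)
    then show ?thesis
      using c by (auto simp: stellar_map_def \<phi>_def)
  qed
  have "homeomorphic_maps ?X' ?X ?\<psi> \<phi>"
    by (simp add: homeomorphic_maps_def cont_\<phi> cont_\<psi> \<psi>\<phi> \<phi>\<psi>)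
  then show ?thesis
    using homeomorphic_map_maps by blast
qed

section \<open>Affine simplices given by lists of vertices\<close>

definition vertex_simplex :: "nat \<Rightarrow> (nat \<Rightarrow> nat) \<Rightarrow> (nat \<Rightarrow> real) \<Rightarrow> nat \<Rightarrow> real" where
  "vertex_simplex p h = oriented_simplex p (\<lambda>j. vertex_point (h j))"

text \<open>The coface map: the increasing enumeration of the natural numbers other than
  \<open>k\<close>.\<close>

definition skip :: "nat \<Rightarrow> nat \<Rightarrow> nat" where
  "skip k j = (if j < k then j else Suc j)"

lemma skip_image:
  assumes "k \<le> Suc n"
  shows "skip k ` {..n} = {..Suc n} - {k}"
proof
  show "skip k ` {..n} \<subseteq> {..Suc n} - {k}"
    by (auto simp: skip_def)
  show "{..Suc n} - {k} \<subseteq> skip k ` {..n}"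
  proof
    fix i assume i: "i \<in> {..Suc n} - {k}"
    show "i \<in> skip k ` {..n}"
    proof (cases "i < k")
      case True
      with assms show ?thesis
        by (intro image_eqI [of _ _ i]) (auto simp: skip_def)
    next
      case False
      with i show ?thesis
        by (intro image_eqI [of _ _ "i - 1"]) (auto simp: skip_def)
    qed
  qed
qed

lemma vertex_simplex_cong:
  "(\<And>j. j \<le> p \<Longrightarrow> h j = h' j) \<Longrightarrow> vertex_simplex p h = vertex_simplex p h'"
  by (simp add: vertex_simplex_def oriented_simplex_eq)

lemma vertex_simplex_apply:
  "x \<in> standard_simplex p \<Longrightarrow> vertex_simplex p h x = (\<lambda>u. \<Sum>j | j \<le> p \<and> h j = u. x j)"
  by (auto simp: vertex_simplex_def oriented_simplex_def sum.If_cases if_distrib [of "\<lambda>u. u * _"]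
      intro!: ext sum.cong cong: if_cong)

lemma sum_vertex_simplex:
  assumes "x \<in> standard_simplex p" "finite A" "h ` {..p} \<subseteq> A"
  shows "(\<Sum>u\<in>A. vertex_simplex p h x u) = 1"
proof -
  have "(\<Sum>u\<in>A. \<Sum>j\<in>{j \<in> {..p}. h j = u}. x j) = (\<Sum>j\<le>p. x j)"
    using assms by (intro sum.group) auto
  with assms show ?thesis
    by (simp add: vertex_simplex_apply standard_simplex_def)
qed

lemma vertex_simplex_nonneg:
  "x \<in> standard_simplex p \<Longrightarrow> 0 \<le> vertex_simplex p h x u"
  by (simp add: vertex_simplex_apply standard_simplex_def sum_nonneg)

lemma vertex_simplex_support:
  "x \<in> standard_simplex p \<Longrightarrow> u \<notin> h ` {..p} \<Longrightarrow> vertex_simplex p h x u = 0"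
  unfolding vertex_simplex_apply by (intro sum.neutral) auto

lemma singular_simplex_vertex_simplex:
  assumes "finite (\<Union>\<F>)" "\<rho> \<in> \<F>" "h ` {..p} \<subseteq> \<rho>"
  shows "singular_simplex p (realization (complex_from_facets \<F>)) (vertex_simplex p h)"
proof -
  have "vertex_simplex p h x \<in> topspace (realization (complex_from_facets \<F>))"
    if x: "x \<in> standard_simplex p" for x
  proof -
    have "(\<Sum>u\<in>\<Union>\<F>. vertex_simplex p h x u) = 1"
      using assms by (intro sum_vertex_simplex [OF x]) auto
    moreover have "\<forall>u. u \<notin> \<rho> \<longrightarrow> vertex_simplex p h x u = 0"
      using vertex_simplex_support [OF x] assms by blast
    ultimately show ?thesis
      unfolding in_realization_complex_from_facets [OF assms(1) order_refl]
      using vertex_simplex_nonneg [OF x] assms by blast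
  qed
  moreover have "singular_simplex p (powertop_real UNIV) (vertex_simplex p h)"
    by (simp add: vertex_simplex_def singular_simplex_oriented_simplex)
  ultimately show ?thesis
    unfolding realization_def singular_simplex_subtopology by auto
qed

lemma singular_face_vertex_simplex:
  "k \<le> Suc p \<Longrightarrow> singular_face (Suc p) k (vertex_simplex (Suc p) h) = vertex_simplex p (h \<circ> skip k)"
  unfolding vertex_simplex_def
  by (subst singular_face_oriented_simplex) (auto simp: oriented_simplex_eq skip_def)

text \<open>Summing over the fibres of \<open>h\<close> and then over those of \<open>L\<close> is
  summing over the fibres of \<open>L \<circ> h\<close>. Off the standard simplex both sides are
  \<open>undefined\<close>.\<close>

lemma simplex_map_simplicial_extension:
  assumes fin: "finite (vertices K)" and h: "h ` {..p} \<subseteq> vertices K"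
  shows "simplex_map p (simplicial_extension K L) (vertex_simplex p h) = vertex_simplex p (L \<circ> h)"
proof
  fix x
  show "simplex_map p (simplicial_extension K L) (vertex_simplex p h) x = vertex_simplex p (L \<circ> h) x"
  proof (cases "x \<in> standard_simplex p")
    case True
    have "(\<Sum>v | v \<in> vertices K \<and> L v = w. \<Sum>j | j \<le> p \<and> h j = v. x j) = (\<Sum>j | j \<le> p \<and> L (h j) = w. x j)" for w
    proof -
      have "(\<Sum>v | v \<in> vertices K \<and> L v = w. \<Sum>j | j \<in> {j. j \<le> p \<and> L (h j) = w} \<and> h j = v. x j) =
            (\<Sum>j | j \<le> p \<and> L (h j) = w. x j)"
        using fin h by (intro sum.group) auto
      moreover have "{j. j \<in> {j. j \<le> p \<and> L (h j) = w} \<and> h j = v} = {j. j \<le> p \<and> h j = v}" if "L v = w" for v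
        using that by auto
      ultimately show ?thesis
        by simp
    qed
    with True show ?thesis
      by (simp add: simplex_map_def simplicial_extension_def vertex_simplex_apply)
  next
    case False
    then show ?thesis
      by (simp add: simplex_map_def vertex_simplex_def oriented_simplex_def)
  qed
qed


subsection \<open>Coloured stacked spheres\<close>

type_synonym facet = "nat \<times> (nat \<Rightarrow> nat)"

definition facet_vertices :: "nat \<Rightarrow> facet \<Rightarrow> nat set" where
  "facet_vertices n x = snd x ` ({..Suc n} - {fst x})"

text \<open>The sign is that of the face opposite to vertex \<open>fst x\<close> in the boundary of
  a simplex. With it, all facets of the boundary of the simplex get the weight 1, and in general the
  weight of a facet in \<open>facet_cycle\<close> is its sign under the colouring.\<close>

definition facet_chain :: "nat \<Rightarrow> facet \<Rightarrow> (nat \<Rightarrow> real) chain" where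
  "facet_chain n x = frag_cmul ((-1) ^ fst x) (frag_of (vertex_simplex n (snd x \<circ> skip (fst x))))"

definition facet_cycle :: "nat \<Rightarrow> facet set \<Rightarrow> (facet \<Rightarrow> int) \<Rightarrow> (nat \<Rightarrow> real) chain" where
  "facet_cycle n F t = (\<Sum>x\<in>F. frag_cmul (t x) (facet_chain n x))"

abbreviation facet_complex :: "nat \<Rightarrow> facet set \<Rightarrow> nat set set" where
  "facet_complex n F \<equiv> complex_from_facets (facet_vertices n ` F)"

lemma chain_boundary_vertex_simplex:
  "chain_boundary (Suc n) (frag_of (vertex_simplex (Suc n) g)) = (\<Sum>k\<le>Suc n. facet_chain n (k, g))"
  unfolding chain_boundary_of facet_chain_def
  by (simp add: singular_face_vertex_simplex del: sum.atMost_Suc)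

lemma simplex_boundary_cycle_eq: "simplex_boundary_cycle n = (\<Sum>k\<le>Suc n. facet_chain n (k, Suc))"
  unfolding simplex_boundary_cycle_def chain_boundary_vertex_simplex [symmetric]
  by (simp add: vertex_simplex_def)

text \<open>The map \<open>skip k\<close> never takes the value \<open>k\<close>. Hence the entry at
  the missing colour can be altered freely, to insert a new vertex or to replace a colouring by
  \<open>Suc\<close>.\<close>

lemma facet_chain_cong:
  assumes "k \<le> Suc n" "\<And>i. i \<le> Suc n \<Longrightarrow> i \<noteq> k \<Longrightarrow> g i = g' i"
  shows "facet_chain n (k, g) = facet_chain n (k, g')"
proof -
  have "vertex_simplex n (g \<circ> skip k) = vertex_simplex n (g' \<circ> skip k)"
  proof (rule vertex_simplex_cong)
    fix j assume "j \<le> n"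
    then have "skip k j \<in> {..Suc n} - {k}"
      using skip_image [OF assms(1)] by blast
    with assms(2) show "(g \<circ> skip k) j = (g' \<circ> skip k) j"
      by simp
  qed
  then show ?thesis
    by (simp add: facet_chain_def)
qed

lemma skip_image_facet_vertices:
  "fst x \<le> Suc n \<Longrightarrow> (snd x \<circ> skip (fst x)) ` {..n} = facet_vertices n x"
  unfolding image_comp [symmetric] by (simp add: skip_image facet_vertices_def)

lemma singular_chain_facet_cycle:
  assumes "finite F" "\<And>x. x \<in> F \<Longrightarrow> fst x \<le> Suc n"
  shows "singular_chain n (realization (facet_complex n F)) (facet_cycle n F t)"
  unfolding facet_cycle_def facet_chain_def
proof (intro singular_chain_sum singular_chain_cmul)
  fix x assume x: "x \<in> F"
  have "finite (\<Union>(facet_vertices n ` F))"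
    using assms by (auto simp: facet_vertices_def)
  with x assms skip_image_facet_vertices [of x n]
  show "singular_chain n (realization (facet_complex n F)) (frag_of (vertex_simplex n (snd x \<circ> skip (fst x))))"
    unfolding singular_chain_of
    by (intro singular_simplex_vertex_simplex [of _ "facet_vertices n x"]) auto
qed

text \<open>The pair \<open>(c, g)\<close> stands for the facet with vertices \<open>g i\<close>, \<open>i \<noteq> c\<close>, where \<open>g i\<close> has the colour
  \<open>i + 1\<close> and the colour \<open>c + 1\<close> is missing; the value \<open>g c\<close> is irrelevant.\<close>

definition coloured_sphere ::
    "nat \<Rightarrow> nat \<Rightarrow> facet set \<Rightarrow> (facet \<Rightarrow> int) \<Rightarrow> (nat \<Rightarrow> nat) \<Rightarrow> ((nat \<Rightarrow> real) \<Rightarrow> nat \<Rightarrow> real) \<Rightarrow> int \<Rightarrow> bool"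
  where
  "coloured_sphere n N F t L \<Psi> d \<longleftrightarrow>
     finite F \<and> inj_on (facet_vertices n) F \<and> \<Union>(facet_vertices n ` F) = {1..N} \<and>
     (\<forall>x\<in>F. fst x \<le> Suc n \<and> (\<forall>i\<le>Suc n. i \<noteq> fst x \<longrightarrow> L (snd x i) = Suc i)) \<and>
     chain_boundary n (facet_cycle n F t) = 0 \<and>
     homeomorphic_map (realization (facet_complex n F)) (realization (simplex_boundary n)) \<Psi> \<and>
     homologous_rel n (realization (simplex_boundary n)) {}
       (chain_map n \<Psi> (facet_cycle n F t)) (simplex_boundary_cycle n) \<and>
     (\<Sum>x\<in>F. frag_cmul (t x) (facet_chain n (fst x, Suc))) = frag_cmul d (simplex_boundary_cycle n)"

lemma coloured_sphere_simplex_boundary: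
  "coloured_sphere n (n + 2) ((\<lambda>c. (c, Suc)) ` {..Suc n}) (\<lambda>x. 1) id id 1"
proof -
  let ?F = "(\<lambda>c. (c, Suc)) ` {..Suc n}"
  have inj: "inj_on (\<lambda>c. (c, Suc)) {..Suc n}"
    by (auto simp: inj_on_def)
  have cyc: "facet_cycle n ?F (\<lambda>x. 1) = simplex_boundary_cycle n"
    unfolding facet_cycle_def simplex_boundary_cycle_eq sum.reindex [OF inj] by simp
  have cyc': "(\<Sum>x\<in>?F. frag_cmul 1 (facet_chain n (fst x, Suc))) = frag_cmul 1 (simplex_boundary_cycle n)"
    unfolding simplex_boundary_cycle_eq sum.reindex [OF inj] by simp
  have fv: "facet_vertices n (c, Suc) = {1..n+2} - {Suc c}" for c
  proof -
    have "Suc ` {..Suc n} = {1..n+2}"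
      by (simp add: image_Suc_atMost)
    then show ?thesis
      by (simp add: facet_vertices_def image_set_diff)
  qed
  have injF: "inj_on (facet_vertices n) ?F"
  proof (rule inj_onI)
    fix x y assume "x \<in> ?F" "y \<in> ?F" and eq: "facet_vertices n x = facet_vertices n y"
    then obtain c c' where "c \<le> Suc n" "c' \<le> Suc n" "x = (c, Suc)" "y = (c', Suc)"
      by auto
    with eq have "{1..n+2} - {Suc c} = {1..n+2} - {Suc c'}" "Suc c \<in> {1..n+2}"
      by (auto simp: fv)
    then have "c = c'"
      by blast
    then show "x = y"
      by (simp add: \<open>x = _\<close> \<open>y = _\<close>)
  qed
  \<comment> \<open>A set of colours is proper iff it misses some colour \<open>Suc c\<close>, that
    is, iff it lies in the facet \<open>(c, Suc)\<close>.\<close>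
  have cx: "facet_complex n ?F = simplex_boundary n"
  proof -
    have "(\<exists>c\<le>Suc n. \<sigma> \<subseteq> {1..n+2} - {Suc c}) \<longleftrightarrow> \<sigma> \<subset> {1..n+2}" for \<sigma>
    proof
      assume "\<exists>c\<le>Suc n. \<sigma> \<subseteq> {1..n+2} - {Suc c}"
      then obtain c where "c \<le> Suc n" "\<sigma> \<subseteq> {1..n+2} - {Suc c}"
        by blast
      moreover from this have "Suc c \<in> {1..n+2}"
        by simp
      ultimately show "\<sigma> \<subset> {1..n+2}"
        by blast
    next
      assume \<sigma>: "\<sigma> \<subset> {1..n+2}"
      then obtain v where v: "v \<in> {1..n+2}" "v \<notin> \<sigma>"
        by blast
      with \<sigma> show "\<exists>c\<le>Suc n. \<sigma> \<subseteq> {1..n+2} - {Suc c}"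
        by (intro exI [of _ "v - 1"]) auto
    qed
    then show ?thesis
      by (simp add: complex_from_facets_def simplex_boundary_def fv Bex_def atMost_def)
  qed
  have "\<Union>(facet_vertices n ` ?F) = {1..n+2}"
    using vertices_complex_from_facets [of "facet_vertices n ` ?F"] unfolding cx vertices_simplex_boundary
    by simp
  moreover have "singular_chain (Suc n) (powertop_real UNIV) (frag_of (vertex_simplex (Suc n) Suc))"
    by (simp add: singular_chain_of vertex_simplex_def singular_simplex_oriented_simplex)
  then have "chain_boundary n (simplex_boundary_cycle n) = 0"
    unfolding simplex_boundary_cycle_eq chain_boundary_vertex_simplex [symmetric]
    by (rule chain_boundary_boundary_alt)
  moreover have "chain_map n id (simplex_boundary_cycle n) = simplex_boundary_cycle n"
  proof (rule chain_map_ident)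
    have "singular_chain n (realization (facet_complex n ?F)) (facet_cycle n ?F (\<lambda>x. 1))"
      by (rule singular_chain_facet_cycle) auto
    then show "singular_chain n (realization (facet_complex n ?F)) (simplex_boundary_cycle n)"
      unfolding cyc .
  qed
  ultimately show ?thesis
    unfolding coloured_sphere_def cyc cyc' cx using injF by (auto simp: homeomorphic_map_id)
qed

section \<open>Stacking one facet\<close>

locale stacking =
  fixes n N :: nat and F :: "facet set" and t L \<Psi> d c g
  assumes n: "1 \<le> n"
    and sphere: "coloured_sphere n N F t L \<Psi> d"
    and cg: "(c, g) \<in> F"
begin

text \<open>\<open>\<tau>\<close> lists the n+2 vertices of the full simplex over the stacked facet,
  in the order of their colours: the irrelevant entry of \<open>g\<close> at \<open>c\<close> is
  filled with the new vertex. The faces of this simplex are the old facet, opposite to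
  \<open>c\<close>, and the facets in \<open>new\<close>. Subtracting \<open>t (c, g)\<close> times
  its boundary removes the old facet, which explains the signs in \<open>t'\<close>.\<close>

definition \<tau> :: "nat \<Rightarrow> nat" where "\<tau> = g(c := Suc N)"
definition new :: "facet set" where "new = (\<lambda>k. (k, \<tau>)) ` ({..Suc n} - {c})"
definition F' where "F' = F - {(c, g)} \<union> new"
definition t' where "t' = (\<lambda>x. if x \<in> F - {(c, g)} then t x else - t (c, g))"
definition L' where "L' = L(Suc N := Suc c)"
abbreviation \<sigma> where "\<sigma> \<equiv> facet_vertices n (c, g)"
abbreviation \<psi> where "\<psi> \<equiv> stellar_map \<sigma> (Suc N)"

lemma fin: "finite F" and inj: "inj_on (facet_vertices n) F"
  and union: "\<Union>(facet_vertices n ` F) = {1..N}"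
  and fst_le: "\<And>x. x \<in> F \<Longrightarrow> fst x \<le> Suc n"
  and colour: "\<And>x i. x \<in> F \<Longrightarrow> i \<le> Suc n \<Longrightarrow> i \<noteq> fst x \<Longrightarrow> L (snd x i) = Suc i"
  using sphere by (auto simp: coloured_sphere_def)

lemma c_le: "c \<le> Suc n"
  using fst_le [OF cg] by simp

lemma facet_vertices_subset: "x \<in> F \<Longrightarrow> facet_vertices n x \<subseteq> {1..N}"
  using union by blast

lemma \<tau>_colour: "i \<le> Suc n \<Longrightarrow> L' (\<tau> i) = Suc i"
proof -
  assume i: "i \<le> Suc n"
  show ?thesis
  proof (cases "i = c")
    case True
    then show ?thesis
      by (simp add: \<tau>_def L'_def)
  next
    case False
    then have "g i \<in> \<sigma>"
      using i by (auto simp: facet_vertices_def)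
    then have "g i \<noteq> Suc N"
      using facet_vertices_subset [OF cg] by auto
    then show ?thesis
      using colour [OF cg i] False by (simp add: \<tau>_def L'_def)
  qed
qed

lemma inj_\<tau>: "inj_on \<tau> {..Suc n}"
  by (rule inj_onI) (metis \<tau>_colour atMost_iff old.nat.inject)

lemma new_vertices:
  assumes "k \<in> {..Suc n} - {c}"
  shows "facet_vertices n (k, \<tau>) = insert (Suc N) (\<sigma> - {g k})"
proof -
  have "facet_vertices n (k, \<tau>) = \<tau> ` {..Suc n} - {\<tau> k}"
    unfolding facet_vertices_def using assms inj_\<tau> by (subst inj_on_image_set_diff) auto
  also have "\<tau> ` {..Suc n} = insert (Suc N) \<sigma>"
    using c_le by (auto simp: facet_vertices_def \<tau>_def image_iff)
  also have "insert (Suc N) \<sigma> - {\<tau> k} = insert (Suc N) (\<sigma> - {g k})"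
  proof -
    have "g k \<in> \<sigma>"
      using assms by (auto simp: facet_vertices_def)
    then show ?thesis
      using facet_vertices_subset [OF cg] assms by (auto simp: \<tau>_def)
  qed
  finally show ?thesis .
qed

lemma new_vertex_in:
  assumes "x \<in> new"
  shows "Suc N \<in> facet_vertices n x"
  using assms new_vertices by (auto simp: new_def)

lemma new_disjoint: "new \<inter> F = {}"
  using new_vertex_in facet_vertices_subset by fastforce

lemma fin': "finite F'"
  using fin by (simp add: F'_def new_def)

lemma inj_new: "inj_on (facet_vertices n) new"
proof (rule inj_onI)
  fix x y assume "x \<in> new" "y \<in> new" and eq: "facet_vertices n x = facet_vertices n y"
  then obtain k l where kl: "k \<in> {..Suc n} - {c}" "x = (k, \<tau>)" "l \<in> {..Suc n} - {c}" "y = (l, \<tau>)"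
    by (auto simp: new_def)
  then have "\<tau> ` ({..Suc n} - {k}) = \<tau> ` ({..Suc n} - {l})"
    using eq by (simp add: facet_vertices_def)
  then have "{..Suc n} - {k} = {..Suc n} - {l}"
    using inj_\<tau> inj_on_image_eq_iff by (metis Diff_subset)
  with kl have "k = l"
    by blast
  with kl show "x = y"
    by simp
qed

lemma inj': "inj_on (facet_vertices n) F'"
proof -
  have "facet_vertices n x \<noteq> facet_vertices n y" if "x \<in> F" "y \<in> new" for x y
    using that new_vertex_in facet_vertices_subset by fastforce
  moreover have "inj_on (facet_vertices n) (F - {(c, g)})"
    using inj by (rule inj_on_subset) auto
  ultimately show ?thesis
    unfolding F'_def by (subst inj_on_Un) (auto simp: inj_new)
qed

lemma facet_vertices_F': "facet_vertices n ` F' = stellar_facets (facet_vertices n ` F) \<sigma> (Suc N)"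
proof -
  have "facet_vertices n ` (F - {(c, g)}) = facet_vertices n ` F - {\<sigma>}"
    using inj cg by (subst inj_on_image_set_diff) auto
  moreover have "facet_vertices n ` new = (\<lambda>k. insert (Suc N) (\<sigma> - {g k})) ` ({..Suc n} - {c})"
    unfolding new_def image_image using new_vertices by (intro image_cong) auto
  then have "facet_vertices n ` new = (\<lambda>u. insert (Suc N) (\<sigma> - {u})) ` \<sigma>"
    by (simp add: facet_vertices_def image_image)
  ultimately show ?thesis
    by (simp add: F'_def stellar_facets_def image_Un)
qed

lemma union': "\<Union>(facet_vertices n ` F') = {1..Suc N}"
proof
  show "\<Union>(facet_vertices n ` F') \<subseteq> {1..Suc N}"
  proof
    fix u assume "u \<in> \<Union>(facet_vertices n ` F')"
    then have "u = Suc N \<or> u \<in> \<sigma> \<or> u \<in> \<Union>(facet_vertices n ` F)"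
      unfolding facet_vertices_F' stellar_facets_def by blast
    then show "u \<in> {1..Suc N}"
      using facet_vertices_subset [OF cg] unfolding union by auto
  qed
next
  have inj_g: "inj_on g ({..Suc n} - {c})"
  proof (rule inj_onI)
    fix i j assume "i \<in> {..Suc n} - {c}" "j \<in> {..Suc n} - {c}" "g i = g j"
    then show "i = j"
      using colour [OF cg, of i] colour [OF cg, of j] by simp
  qed
  \<comment> \<open>As n is at least 1, \<open>\<sigma>\<close> has at least two vertices. So each
    of them survives in a new facet that drops another one, and no vertex is lost.\<close>
  have other: "\<exists>u'\<in>\<sigma>. u' \<noteq> u" for u
  proof -
    have "card \<sigma> = Suc n"
      unfolding facet_vertices_def using inj_g c_le by (simp add: card_image)
    then have "\<not> \<sigma> \<subseteq> {u}"
      using n card_mono [of "{u}" \<sigma>] by auto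
    then show ?thesis
      by blast
  qed
  show "{1..Suc N} \<subseteq> \<Union>(facet_vertices n ` F')"
  proof
    fix u assume "u \<in> {1..Suc N}"
    then consider "u = Suc N" | "u \<in> \<sigma>" | "u \<in> \<Union>(facet_vertices n ` F)" "u \<notin> \<sigma>"
      unfolding union by (auto simp: le_Suc_eq)
    then show "u \<in> \<Union>(facet_vertices n ` F')"
    proof cases
      case 1
      obtain w where "w \<in> \<sigma>"
        using other by blast
      with 1 show ?thesis
        unfolding facet_vertices_F' stellar_facets_def by blast
    next
      case 2
      obtain w where "w \<in> \<sigma>" "w \<noteq> u"
        using other by blast
      with 2 show ?thesis
        unfolding facet_vertices_F' stellar_facets_def by blast
    next
      case 3
      then show ?thesis
        unfolding facet_vertices_F' stellar_facets_def by blast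
    qed
  qed
qed

lemma colour': "x \<in> F' \<Longrightarrow> fst x \<le> Suc n \<and> (\<forall>i\<le>Suc n. i \<noteq> fst x \<longrightarrow> L' (snd x i) = Suc i)"
proof -
  assume "x \<in> F'"
  then consider "x \<in> F" | "x \<in> new"
    by (auto simp: F'_def)
  then show ?thesis
  proof cases
    case 1
    have "L' (snd x i) = L (snd x i)" if "i \<le> Suc n" "i \<noteq> fst x" for i
    proof -
      have "snd x i \<in> facet_vertices n x"
        using that by (auto simp: facet_vertices_def)
      then show ?thesis
        using facet_vertices_subset [OF 1] by (auto simp: L'_def)
    qed
    with 1 show ?thesis
      using fst_le colour by simp
  next
    case 2
    then show ?thesis
      using \<tau>_colour by (auto simp: new_def)
  qed
qed

text \<open>The old facet leaves and the others of the full simplex enter with the opposite sign; by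
  the hypothesis on \<open>h\<close> these changes form a complete boundary sum. It is applied
  twice: to the facet chains, for the cycle, and to their images under the colouring, for the
  degree.\<close>

lemma sum_F':
  fixes h :: "facet \<Rightarrow> (nat \<Rightarrow> real) chain"
  assumes "h (c, \<tau>) = h (c, g)"
  shows "(\<Sum>x\<in>F'. frag_cmul (t' x) (h x)) =
         (\<Sum>x\<in>F. frag_cmul (t x) (h x)) - frag_cmul (t (c, g)) (\<Sum>k\<le>Suc n. h (k, \<tau>))"
proof -
  have "(\<Sum>x\<in>F'. frag_cmul (t' x) (h x)) =
        (\<Sum>x\<in>F - {(c, g)}. frag_cmul (t' x) (h x)) + (\<Sum>x\<in>new. frag_cmul (t' x) (h x))"
    unfolding F'_def using fin new_disjoint by (intro sum.union_disjoint) (auto simp: new_def)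
  also have "(\<Sum>x\<in>F - {(c, g)}. frag_cmul (t' x) (h x)) = (\<Sum>x\<in>F - {(c, g)}. frag_cmul (t x) (h x))"
    by (intro sum.cong) (auto simp: t'_def)
  also have "\<dots> = (\<Sum>x\<in>F. frag_cmul (t x) (h x)) - frag_cmul (t (c, g)) (h (c, g))"
    using fin cg by (simp add: sum_diff1)
  also have "(\<Sum>x\<in>new. frag_cmul (t' x) (h x)) = (\<Sum>x\<in>new. frag_cmul (- t (c, g)) (h x))"
    using new_disjoint by (intro sum.cong) (auto simp: t'_def)
  also have "\<dots> = frag_cmul (- t (c, g)) (\<Sum>x\<in>new. h x)"
    by (simp add: frag_cmul_sum)
  also have "(\<Sum>x\<in>new. h x) = (\<Sum>k\<in>{..Suc n} - {c}. h (k, \<tau>))"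
    unfolding new_def by (subst sum.reindex) (auto simp: inj_on_def)
  also have "\<dots> = (\<Sum>k\<le>Suc n. h (k, \<tau>)) - h (c, g)"
    using c_le assms by (simp add: sum_diff1 del: sum.atMost_Suc)
  also have "frag_cmul (- t (c, g)) ((\<Sum>k\<le>Suc n. h (k, \<tau>)) - h (c, g)) =
      frag_cmul (t (c, g)) (h (c, g)) - frag_cmul (t (c, g)) (\<Sum>k\<le>Suc n. h (k, \<tau>))"
    by (rule poly_mapping_eqI) (simp add: lookup_minus algebra_simps del: sum.atMost_Suc)
  finally show ?thesis
    by simp
qed

lemma facet_cycle_F':
  "facet_cycle n F' t' = facet_cycle n F t -
     frag_cmul (t (c, g)) (chain_boundary (Suc n) (frag_of (vertex_simplex (Suc n) \<tau>)))"
  unfolding facet_cycle_def chain_boundary_vertex_simplex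
  using c_le by (intro sum_F' facet_chain_cong) (auto simp: \<tau>_def)

lemma degree_F':
  "(\<Sum>x\<in>F'. frag_cmul (t' x) (facet_chain n (fst x, Suc))) =
     frag_cmul (d - t (c, g)) (simplex_boundary_cycle n)"
proof -
  have "(\<Sum>x\<in>F'. frag_cmul (t' x) (facet_chain n (fst x, Suc))) =
        (\<Sum>x\<in>F. frag_cmul (t x) (facet_chain n (fst x, Suc))) -
        frag_cmul (t (c, g)) (\<Sum>k\<le>Suc n. facet_chain n (fst (k, \<tau>), Suc))"
    by (rule sum_F') simp
  also have "(\<Sum>x\<in>F. frag_cmul (t x) (facet_chain n (fst x, Suc))) = frag_cmul d (simplex_boundary_cycle n)"
    using sphere by (simp add: coloured_sphere_def)
  finally show ?thesis
    unfolding fst_conv simplex_boundary_cycle_eq [symmetric]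
    by (simp add: frag_cmul_diff_distrib)
qed

text \<open>The complex is pure: the vertices of a facet have different colours, so every facet has
  n+1 of them.\<close>

lemma \<sigma>_maximal:
  assumes "\<rho> \<in> facet_vertices n ` F" "\<sigma> \<subseteq> \<rho>"
  shows "\<rho> = \<sigma>"
proof -
  have card: "card (facet_vertices n x) = Suc n" if x: "x \<in> F" for x
  proof -
    have "inj_on (snd x) ({..Suc n} - {fst x})"
    proof (rule inj_onI)
      fix i j assume ij: "i \<in> {..Suc n} - {fst x}" "j \<in> {..Suc n} - {fst x}" and eq: "snd x i = snd x j"
      have "Suc i = L (snd x i)"
        using colour [OF x, of i] ij by auto
      also have "\<dots> = Suc j"
        unfolding eq using colour [OF x, of j] ij by auto
      finally show "i = j"
        by simp
    qed
    then show ?thesis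
      unfolding facet_vertices_def using fst_le [OF x] by (simp add: card_image)
  qed
  then have "card \<rho> = card \<sigma>" "finite \<rho>"
    using assms(1) cg by (auto simp: facet_vertices_def)
  with assms(2) show ?thesis
    by (metis card_subset_eq)
qed

lemma finite_union: "finite (\<Union>(facet_vertices n ` F))"
  by (simp add: union)

lemma \<sigma>_nonempty: "\<sigma> \<noteq> {}"
proof -
  obtain i where "i \<in> {..Suc n} - {c}"
    using n by (cases "c = 0") auto
  then show ?thesis
    by (auto simp: facet_vertices_def)
qed

lemma homeo:
  "homeomorphic_map (realization (facet_complex n F')) (realization (facet_complex n F)) \<psi>"
  unfolding facet_vertices_F'
  using cg \<sigma>_maximal by (intro homeomorphic_map_stellar_map finite_union \<sigma>_nonempty) (auto simp: union)

text \<open>The new cycle differs from the old one by the boundary of the full simplex \<open>\<tau>\<close>, which the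
  projection \<open>\<psi>\<close> flattens into the subdivided facet.\<close>

lemma chain_map_facet_cycle_F':
  obtains \<xi> where "singular_chain (Suc n) (realization (facet_complex n F)) \<xi>"
    "chain_map n \<psi> (facet_cycle n F' t') = facet_cycle n F t - chain_boundary (Suc n) \<xi>"
proof
  let ?s = "frag_of (vertex_simplex (Suc n) \<tau>)"
  let ?X = "realization (facet_complex n F)"
  define \<xi> where "\<xi> = frag_cmul (t (c, g)) (chain_map (Suc n) \<psi> ?s)"
  have s: "singular_chain (Suc n) (powertop_real UNIV) ?s"
    by (simp add: singular_chain_of vertex_simplex_def singular_simplex_oriented_simplex)
  have z: "singular_chain n ?X (facet_cycle n F t)"
    by (intro singular_chain_facet_cycle fin fst_le)
  \<comment> \<open>On the old realization the new vertex has weight 0, so \<open>\<psi>\<close>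
    fixes every point of it.\<close>
  have "chain_map n \<psi> (facet_cycle n F t) = facet_cycle n F t"
  proof (rule chain_map_id_gen [OF z])
    fix x assume "x \<in> topspace ?X"
    then obtain \<rho> where "\<rho> \<in> facet_vertices n ` F" "\<forall>u. u \<notin> \<rho> \<longrightarrow> x u = 0"
      using in_realization_complex_from_facets [OF finite_union order_refl] by blast
    moreover from this have "Suc N \<notin> \<rho>"
      using facet_vertices_subset by fastforce
    ultimately show "\<psi> x = x"
      by (intro stellar_map_ident) simp
  qed
  then show "chain_map n \<psi> (facet_cycle n F' t') = facet_cycle n F t - chain_boundary (Suc n) \<xi>"
    using chain_boundary_chain_map [OF s, of \<psi>]
    by (simp add: facet_cycle_F' chain_map_diff \<xi>_def chain_boundary_cmul)
  have \<tau>_image: "\<tau> ` {..Suc n} = insert (Suc N) \<sigma>"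
    using c_le by (auto simp: facet_vertices_def \<tau>_def image_iff)
  have "singular_simplex (Suc n) ?X (simplex_map (Suc n) \<psi> (vertex_simplex (Suc n) \<tau>))"
    unfolding realization_def singular_simplex_subtopology
  proof
    show "singular_simplex (Suc n) (powertop_real UNIV) (simplex_map (Suc n) \<psi> (vertex_simplex (Suc n) \<tau>))"
      using singular_simplex_simplex_map [OF _ continuous_map_stellar_map] s
      by (simp add: singular_chain_of)
    have "\<psi> (vertex_simplex (Suc n) \<tau> x) \<in> topspace ?X" if x: "x \<in> standard_simplex (Suc n)" for x
    proof (rule stellar_map_in_realization [OF finite_union _ \<sigma>_nonempty])
      show "\<sigma> \<in> facet_vertices n ` F" "\<sigma> \<in> facet_vertices n ` F"
        using cg by blast+
      show "Suc N \<notin> \<Union>(facet_vertices n ` F)"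
        by (simp add: union)
      show "0 \<le> vertex_simplex (Suc n) \<tau> x u" for u
        by (rule vertex_simplex_nonneg [OF x])
      have "\<tau> ` {..Suc n} \<subseteq> insert (Suc N) (\<Union>(facet_vertices n ` F))"
        unfolding \<tau>_image using cg by blast
      then show "(\<Sum>u\<in>insert (Suc N) (\<Union>(facet_vertices n ` F)). vertex_simplex (Suc n) \<tau> x u) = 1"
        using finite_union by (intro sum_vertex_simplex [OF x]) auto
      show "vertex_simplex (Suc n) \<tau> x u = 0" if "u \<notin> insert (Suc N) \<sigma>" for u
        using that by (intro vertex_simplex_support [OF x]) (simp only: \<tau>_image not_False_eq_True)
    qed simp
    then show "simplex_map (Suc n) \<psi> (vertex_simplex (Suc n) \<tau>) ` standard_simplex (Suc n) \<subseteq>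
        {x. (\<forall>v. 0 \<le> x v) \<and> {v. x v \<noteq> 0} \<in> facet_complex n F \<and> (\<Sum>v\<in>vertices (facet_complex n F). x v) = 1}"
      unfolding topspace_realization by (auto simp: simplex_map_def)
  qed
  then show "singular_chain (Suc n) ?X \<xi>"
    by (simp add: \<xi>_def singular_chain_cmul singular_chain_of)
qed

text \<open>Under \<open>\<Psi> \<circ> \<psi>\<close> the image of the new cycle differs from the
  image of the old one under \<open>\<Psi>\<close> by the boundary of the image of
  \<open>\<xi>\<close>, so its homology class is unchanged. Only the colouring notices the removed
  simplex boundary, at the expense of \<open>t (c, g)\<close> in the degree.\<close>

lemma coloured_sphere_stacked: "coloured_sphere n (Suc N) F' t' L' (\<Psi> \<circ> \<psi>) (d - t (c, g))"
proof -
  let ?X = "realization (facet_complex n F)"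
  let ?Y = "realization (simplex_boundary n)"
  have \<Psi>: "homeomorphic_map ?X ?Y \<Psi>"
    and hom: "homologous_rel n ?Y {} (chain_map n \<Psi> (facet_cycle n F t)) (simplex_boundary_cycle n)"
    and cyc: "chain_boundary n (facet_cycle n F t) = 0"
    using sphere by (auto simp: coloured_sphere_def)
  obtain \<xi> where \<xi>: "singular_chain (Suc n) ?X \<xi>"
    and \<xi>_eq: "chain_map n \<psi> (facet_cycle n F' t') = facet_cycle n F t - chain_boundary (Suc n) \<xi>"
    by (rule chain_map_facet_cycle_F')
  have "singular_relboundary n ?X {} (chain_boundary (Suc n) \<xi>)"
    using \<xi> by (auto simp: singular_boundary)
  then have "singular_relboundary n ?Y {} (chain_map n \<Psi> (chain_boundary (Suc n) \<xi>))"
    using homeomorphic_imp_continuous_map [OF \<Psi>] by (intro singular_relboundary_chain_map) auto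
  then have "singular_relboundary n ?Y {}
      ((chain_map n \<Psi> (facet_cycle n F t) - simplex_boundary_cycle n) - chain_map n \<Psi> (chain_boundary (Suc n) \<xi>))"
    using hom unfolding homologous_rel_def by (rule singular_relboundary_diff [rotated])
  moreover have "chain_map n (\<Psi> \<circ> \<psi>) (facet_cycle n F' t') - simplex_boundary_cycle n =
      (chain_map n \<Psi> (facet_cycle n F t) - simplex_boundary_cycle n) - chain_map n \<Psi> (chain_boundary (Suc n) \<xi>)"
    by (simp add: chain_map_compose \<xi>_eq chain_map_diff)
  ultimately have "homologous_rel n ?Y {} (chain_map n (\<Psi> \<circ> \<psi>) (facet_cycle n F' t')) (simplex_boundary_cycle n)"
    unfolding homologous_rel_def by (simp only:)
  moreover have "homeomorphic_map (realization (facet_complex n F')) ?Y (\<Psi> \<circ> \<psi>)"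
    using homeo \<Psi> by (rule homeomorphic_map_compose)
  moreover have "chain_boundary n (facet_cycle n F' t') = 0"
  proof -
    have "singular_chain (Suc n) (powertop_real UNIV) (frag_of (vertex_simplex (Suc n) \<tau>))"
      by (simp add: singular_chain_of vertex_simplex_def singular_simplex_oriented_simplex)
    then have "chain_boundary n (chain_boundary (Suc n) (frag_of (vertex_simplex (Suc n) \<tau>))) = 0"
      by (rule chain_boundary_boundary_alt)
    then show ?thesis
      using cyc by (simp add: facet_cycle_F' chain_boundary_diff chain_boundary_cmul)
  qed
  ultimately show ?thesis
    unfolding coloured_sphere_def using fin' inj' union' colour' degree_F' by blast
qed

text \<open>A nonzero sign differs from its negative, so the stacked facet leaves the first class
  and the n+1 new facets enter only the second.\<close>

lemma card_F':
  assumes "t (c, g) \<noteq> 0"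
  shows "card {x \<in> F'. t' x = t (c, g)} = card {x \<in> F. t x = t (c, g)} - 1"
    and "card {x \<in> F'. t' x = - t (c, g)} = card {x \<in> F. t x = - t (c, g)} + Suc n"
proof -
  have "{x \<in> F'. t' x = t (c, g)} = {x \<in> F. t x = t (c, g)} - {(c, g)}"
    using assms new_disjoint by (auto simp: F'_def t'_def)
  then show "card {x \<in> F'. t' x = t (c, g)} = card {x \<in> F. t x = t (c, g)} - 1"
    using cg by simp
  have "{x \<in> F'. t' x = - t (c, g)} = {x \<in> F. t x = - t (c, g)} \<union> new"
    using assms new_disjoint by (auto simp: F'_def t'_def)
  moreover have "card new = Suc n"
    unfolding new_def using c_le by (subst card_image) (auto simp: inj_on_def)
  moreover have "finite new" "{x \<in> F. t x = - t (c, g)} \<inter> new = {}"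
    using new_disjoint by (auto simp: new_def)
  ultimately show "card {x \<in> F'. t' x = - t (c, g)} = card {x \<in> F. t x = - t (c, g)} + Suc n"
    using fin by (simp add: card_Un_disjoint)
qed

end

section \<open>From coloured spheres to bounds on \<open>lambda\<close>\<close>

text \<open>Each facet misses a colour, so every image point has a vanishing coordinate and lies on
  the boundary of the simplex.\<close>

lemma continuous_map_simplicial_extension:
  assumes fin: "finite (\<Union>\<F>)"
    and L: "\<And>\<rho>. \<rho> \<in> \<F> \<Longrightarrow> L ` \<rho> \<subset> {1..n+2}"
  shows "continuous_map (realization (complex_from_facets \<F>)) (realization (simplex_boundary n))
           (simplicial_extension (complex_from_facets \<F>) L)"
proof -
  let ?X = "realization (complex_from_facets \<F>)"
  let ?f = "simplicial_extension (complex_from_facets \<F>) L"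
  have f: "?f x w = (\<Sum>v | v \<in> \<Union>\<F> \<and> L v = w. x v)" for x w
    by (simp add: simplicial_extension_def vertices_complex_from_facets)
  have "?f x \<in> topspace (realization (simplex_boundary n))" if "x \<in> topspace ?X" for x
  proof -
    obtain \<rho> where nn: "\<And>u. 0 \<le> x u" and \<rho>: "\<rho> \<in> \<F>" "\<And>u. u \<notin> \<rho> \<Longrightarrow> x u = 0"
      and sum1: "(\<Sum>u\<in>\<Union>\<F>. x u) = 1"
      using \<open>x \<in> topspace ?X\<close> unfolding in_realization_complex_from_facets [OF fin order_refl] by blast
    have L_image: "L ` \<Union>\<F> \<subseteq> {1..n+2}"
      using L by blast
    have zero: "?f x w = 0" if "w \<notin> L ` \<rho>" for w
      unfolding f using \<rho> that by (intro sum.neutral) auto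
    have "(\<Sum>w\<in>{1..n+2}. \<Sum>v\<in>{v \<in> \<Union>\<F>. L v = w}. x v) = (\<Sum>v\<in>\<Union>\<F>. x v)"
      using fin L_image by (intro sum.group) auto
    then have "(\<Sum>w=1..n+2. ?f x w) = 1"
      by (simp only: f sum1)
    moreover have "\<exists>w\<in>{1..n+2}. ?f x w = 0"
      using L [OF \<rho>(1)] zero by (metis psubset_imp_ex_mem DiffD1 DiffD2)
    moreover have "?f x w = 0" if "w \<notin> {1..n+2}" for w
      using L [OF \<rho>(1)] zero that by blast
    moreover have "0 \<le> ?f x w" for w
      unfolding f using nn by (intro sum_nonneg) auto
    ultimately show ?thesis
      unfolding topspace_realization_simplex_boundary by blast
  qed
  moreover have "continuous_map ?X euclideanreal (\<lambda>x. ?f x w)" for w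
    unfolding f
    by (intro continuous_map_sum continuous_map_coordinate_realization finite_subset [OF _ fin]) blast
  ultimately show ?thesis
    unfolding realization_def [of "simplex_boundary n"] continuous_map_in_subtopology
      continuous_map_componentwise_UNIV
    by (simp add: topspace_realization)
qed

text \<open>The colouring sends each facet chain to that of the facet of the simplex missing the
  same colour, hence the cycle to \<open>d\<close> times the fundamental cycle.
  \<open>Brouwer_degree2_conjugate_eq\<close> then provides the triangulating homeomorphism.\<close>

lemma lambda_le:
  assumes n: "1 \<le> n" and sphere: "coloured_sphere n N F t L \<Psi> d"
  shows "lambda n d \<le> enat N"
proof -
  let ?K = "facet_complex n F"
  let ?f = "simplicial_extension ?K L"
  have fin: "finite F" and union: "\<Union>(facet_vertices n ` F) = {1..N}"
    and fst_le: "\<And>x. x \<in> F \<Longrightarrow> fst x \<le> Suc n"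
    and colour: "\<And>x i. x \<in> F \<Longrightarrow> i \<le> Suc n \<Longrightarrow> i \<noteq> fst x \<Longrightarrow> L (snd x i) = Suc i"
    and \<Psi>: "homeomorphic_map (realization ?K) (realization (simplex_boundary n)) \<Psi>"
    and hom: "homologous_rel n (realization (simplex_boundary n)) {}
       (chain_map n \<Psi> (facet_cycle n F t)) (simplex_boundary_cycle n)"
    and cyc: "chain_boundary n (facet_cycle n F t) = 0"
    and deg: "(\<Sum>x\<in>F. frag_cmul (t x) (facet_chain n (fst x, Suc))) = frag_cmul d (simplex_boundary_cycle n)"
    using sphere by (auto simp: coloured_sphere_def)
  have vert: "vertices ?K = {1..N}"
    by (simp add: vertices_complex_from_facets union)
  have L_facet: "L ` facet_vertices n x = {1..n+2} - {Suc (fst x)}" if x: "x \<in> F" for x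
  proof -
    have "L ` facet_vertices n x = Suc ` ({..Suc n} - {fst x})"
      unfolding facet_vertices_def image_image using colour [OF x] by (intro image_cong) auto
    also have "\<dots> = {1..n+2} - {Suc (fst x)}"
      by (simp add: image_set_diff image_Suc_atMost)
    finally show ?thesis .
  qed
  have L_proper: "L ` \<rho> \<subset> {1..n+2}" if "\<rho> \<in> facet_vertices n ` F" for \<rho>
  proof -
    obtain x where x: "x \<in> F" "\<rho> = facet_vertices n x"
      using \<open>\<rho> \<in> facet_vertices n ` F\<close> by blast
    have "Suc (fst x) \<in> {1..n+2}"
      using fst_le [OF x(1)] by simp
    with L_facet [OF x(1)] x(2) show ?thesis
      by blast
  qed
  have L_range: "L ` vertices ?K \<subseteq> {1..n+2}"
    unfolding vertices_complex_from_facets using L_proper by blast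
  have cont_f: "continuous_map (realization ?K) (realization (simplex_boundary n)) ?f"
    by (rule continuous_map_simplicial_extension) (simp_all only: union finite_atLeastAtMost L_proper)
  have z: "singular_relcycle n (realization ?K) {} (facet_cycle n F t)"
    unfolding singular_cycle using singular_chain_facet_cycle [OF fin fst_le] cyc by blast
  have f_facet: "chain_map n ?f (facet_chain n x) = facet_chain n (fst x, Suc)" if x: "x \<in> F" for x
  proof -
    have img: "(snd x \<circ> skip (fst x)) ` {..n} = facet_vertices n x"
      using skip_image_facet_vertices fst_le [OF x] .
    moreover have "facet_vertices n x \<subseteq> {1..N}"
      using x union by blast
    ultimately have "simplex_map n ?f (vertex_simplex n (snd x \<circ> skip (fst x))) =
        vertex_simplex n (L \<circ> (snd x \<circ> skip (fst x)))"
      by (intro simplex_map_simplicial_extension) (simp_all only: vert finite_atLeastAtMost)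
    then have "chain_map n ?f (facet_chain n x) = facet_chain n (fst x, L \<circ> snd x)"
      by (simp add: facet_chain_def comp_assoc)
    \<comment> \<open>The colours are given by \<open>Suc\<close> except perhaps at the missing
      index, which the chain ignores.\<close>
    also have "\<dots> = facet_chain n (fst x, Suc)"
      using colour [OF x] fst_le [OF x] by (intro facet_chain_cong) auto
    finally show ?thesis .
  qed
  have fz: "chain_map n ?f (facet_cycle n F t) = frag_cmul d (simplex_boundary_cycle n)"
    unfolding deg [symmetric] facet_cycle_def using fin f_facet by (simp add: chain_map_sum)
  obtain h where h: "homeomorphic_map (nsphere n) (realization ?K) h"
    and deg_h: "Brouwer_degree2 n (boundary_to_sphere n \<circ> ?f \<circ> h) = d"
    using Brouwer_degree2_conjugate_eq [OF n homeomorphic_map_boundary_to_sphere \<Psi> cont_f z hom fz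
        simplex_boundary_cycle_not_boundary] by blast
  have "?K \<subseteq> Pow {1..N}"
  proof
    fix \<sigma> assume "\<sigma> \<in> ?K"
    then obtain x where "x \<in> F" "\<sigma> \<subseteq> facet_vertices n x"
      unfolding complex_from_facets_def by blast
    then have "\<sigma> \<subseteq> \<Union>(facet_vertices n ` F)"
      by blast
    then show "\<sigma> \<in> Pow {1..N}"
      unfolding union by simp
  qed
  then have "finite ?K"
    by (rule finite_subset) simp
  moreover have "abstract_simplicial_complex ?K"
    unfolding abstract_simplicial_complex_def
  proof (intro conjI ballI allI impI)
    fix \<sigma> assume "\<sigma> \<in> ?K"
    with \<open>?K \<subseteq> Pow {1..N}\<close> show "finite \<sigma>"
      by (meson PowD finite_atLeastAtMost finite_subset subsetD)
    show "\<sigma> \<noteq> {}"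
      using \<open>\<sigma> \<in> ?K\<close> by (simp add: complex_from_facets_def)
    show "\<tau> \<in> ?K" if "\<tau> \<noteq> {} \<and> \<tau> \<subseteq> \<sigma>" for \<tau>
      using \<open>\<sigma> \<in> ?K\<close> that unfolding complex_from_facets_def by blast
  qed
  ultimately have "sphere_triangulation n ?K h"
    using h by (simp add: sphere_triangulation_def)
  moreover have "coloring_degree n ?K h L = d"
    using deg_h by (simp add: coloring_degree_def)
  ultimately have "lambda n d \<le> enat (card (vertices ?K))"
    unfolding lambda_def using L_range by (intro Inf_lower) blast
  then show ?thesis
    by (simp add: vert)
qed


subsection \<open>Counting vertices\<close>

text \<open>Only what decides which stackings are possible is remembered: \<open>p\<close> and
  \<open>q\<close> count the positive and the negative facets.\<close>

definition reachable :: "nat \<Rightarrow> nat \<Rightarrow> int \<Rightarrow> nat \<Rightarrow> nat \<Rightarrow> bool" where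
  "reachable n N d p q \<longleftrightarrow> (\<exists>F t L \<Psi>. coloured_sphere n N F t L \<Psi> d \<and>
     card {x \<in> F. t x = 1} = p \<and> card {x \<in> F. t x = -1} = q)"

lemma reachable_simplex_boundary: "reachable n (n + 2) 1 (n + 2) 0"
proof -
  let ?F = "(\<lambda>c. (c, Suc)) ` {..Suc n}"
  have "card ?F = n + 2"
    by (subst card_image) (auto simp: inj_on_def)
  then show ?thesis
    unfolding reachable_def
    by (intro exI [of _ ?F] exI [of _ "\<lambda>x. 1"] exI [of _ id] conjI coloured_sphere_simplex_boundary) auto
qed

lemma reachable_stack:
  assumes n: "1 \<le> n" and s: "s = 1 \<or> s = -1"
    and sphere: "coloured_sphere n N F t L \<Psi> d" and pos: "card {x \<in> F. t x = s} > 0"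
  obtains F' t' L' \<Psi>' where "coloured_sphere n (Suc N) F' t' L' \<Psi>' (d - s)"
    "card {x \<in> F'. t' x = s} = card {x \<in> F. t x = s} - 1"
    "card {x \<in> F'. t' x = - s} = card {x \<in> F. t x = - s} + Suc n"
proof -
  obtain x where x: "x \<in> F" "t x = s"
    using pos by (auto simp: card_gt_0_iff)
  obtain c g where x_eq: "x = (c, g)"
    by (cases x)
  interpret stacking n N F t L \<Psi> d c g
    using n sphere x x_eq by unfold_locales auto
  have t: "t (c, g) = s" "t (c, g) \<noteq> 0"
    using x x_eq s by auto
  show thesis
  proof (rule that)
    show "coloured_sphere n (Suc N) F' t' L' (\<Psi> \<circ> \<psi>) (d - s)"
      using coloured_sphere_stacked unfolding t(1) .
  qed (use card_F' [OF t(2)] t(1) in simp_all)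
qed

lemma reachable_stack_positive:
  assumes "1 \<le> n" "reachable n N d (Suc p) q"
  shows "reachable n (Suc N) (d - 1) p (q + Suc n)"
proof -
  obtain F t L \<Psi> where *: "coloured_sphere n N F t L \<Psi> d"
    "card {x \<in> F. t x = 1} = Suc p" "card {x \<in> F. t x = -1} = q"
    using assms(2) by (auto simp: reachable_def)
  then have "card {x \<in> F. t x = 1} > 0"
    by simp
  then obtain F' t' L' \<Psi>' where **: "coloured_sphere n (Suc N) F' t' L' \<Psi>' (d - 1)"
    "card {x \<in> F'. t' x = 1} = card {x \<in> F. t x = 1} - 1"
    "card {x \<in> F'. t' x = -1} = card {x \<in> F. t x = -1} + Suc n"
    by (rule reachable_stack [OF assms(1) _ *(1), rotated]) auto
  have "card {x \<in> F'. t' x = 1} = p" "card {x \<in> F'. t' x = -1} = q + Suc n"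
    using **(2,3) *(2,3) by simp_all
  with **(1) show ?thesis
    unfolding reachable_def by blast
qed

lemma reachable_stack_negative:
  assumes "1 \<le> n" "reachable n N d p (Suc q)"
  shows "reachable n (Suc N) (d + 1) (p + Suc n) q"
proof -
  obtain F t L \<Psi> where *: "coloured_sphere n N F t L \<Psi> d"
    "card {x \<in> F. t x = 1} = p" "card {x \<in> F. t x = -1} = Suc q"
    using assms(2) by (auto simp: reachable_def)
  then have "card {x \<in> F. t x = -1} > 0"
    by simp
  then obtain F' t' L' \<Psi>' where **: "coloured_sphere n (Suc N) F' t' L' \<Psi>' (d - (-1))"
    "card {x \<in> F'. t' x = -1} = card {x \<in> F. t x = -1} - 1"
    "card {x \<in> F'. t' x = - (-1)} = card {x \<in> F. t x = - (-1)} + Suc n"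
    by (rule reachable_stack [OF assms(1) _ *(1), rotated]) auto
  have "card {x \<in> F'. t' x = 1} = p + Suc n" "card {x \<in> F'. t' x = -1} = q"
    using **(2,3) *(2,3) by simp_all
  moreover have "coloured_sphere n (Suc N) F' t' L' \<Psi>' (d + 1)"
    using **(1) by simp
  ultimately show ?thesis
    unfolding reachable_def by blast
qed

lemma reachable_stack_negatives:
  assumes "1 \<le> n" "reachable n N d p (q + j)"
  shows "reachable n (N + j) (d + int j) (p + j * Suc n) q"
  using assms(2)
proof (induction j arbitrary: q)
  case (Suc j)
  then have "reachable n (N + j) (d + int j) (p + j * Suc n) (Suc q)"
    using Suc.IH [of "Suc q"] by simp
  from reachable_stack_negative [OF assms(1) this] show ?case
    by (simp add: algebra_simps)
qed simp

text \<open>One positive facet is stacked, then \<open>j\<close> of the n+1 negative facets thus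
  created. A full round has \<open>j = Suc n\<close>; smaller values give the incomplete last
  round.\<close>

lemma reachable_stack_mixed:
  assumes "1 \<le> n" "reachable n N d (Suc p) 0" "j \<le> Suc n"
  shows "reachable n (N + Suc j) (d + int j - 1) (p + j * Suc n) (Suc n - j)"
proof -
  have "reachable n (Suc N) (d - 1) p (Suc n - j + j)"
    using reachable_stack_positive [OF assms(1,2)] assms(3) by simp
  from reachable_stack_negatives [OF assms(1) this] show ?thesis
    by (simp add: algebra_simps)
qed

text \<open>The start has n+2 vertices and degree 1; each of the \<open>k\<close> full rounds adds
  n+2 vertices and n to the degree. It uses up all negative facets and leaves a positive one for the
  next round.\<close>

lemma reachable_rounds:
  assumes "1 \<le> n"
  shows "\<exists>p. reachable n ((n + 2) * (k + 1)) (int (n * k) + 1) (Suc p) 0"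
proof (induction k)
  case 0
  show ?case
    using reachable_simplex_boundary [of n] by (intro exI [of _ "n + 1"]) simp
next
  case (Suc k)
  then obtain p where "reachable n ((n + 2) * (k + 1)) (int (n * k) + 1) (Suc p) 0"
    by blast
  from reachable_stack_mixed [OF assms this order_refl]
  have "reachable n ((n + 2) * (Suc k + 1)) (int (n * Suc k) + 1) (Suc (p + n + n * Suc n)) 0"
    by (simp add: algebra_simps)
  then show ?case
    by blast
qed

lemma lambda_upper_bound:
  assumes n: "1 \<le> n" and d: "0 \<le> d"
  shows "ereal_of_enat (lambda n d) \<le> ereal ((real n + 2) / real n * real_of_int d + (2 * real n + 2))"
proof -
  \<comment> \<open>After \<open>k\<close> full rounds the degree is n k + 1, and a last round with
    \<open>j = r\<close> changes it by r - 1, to n k + r. Even for r = 0 this round is carried out: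
    its positive stacking lowers the degree by 1, which also covers d = 0.\<close>
  define k where "k = nat d div n"
  define r where "r = nat d mod n"
  have dk: "d = int (n * k + r)"
    using d by (simp add: k_def r_def)
  have "r < n"
    using n by (simp add: r_def)
  obtain p where "reachable n ((n + 2) * (k + 1)) (int (n * k) + 1) (Suc p) 0"
    using reachable_rounds [OF n] by blast
  from reachable_stack_mixed [OF n this, of r] \<open>r < n\<close>
  have "reachable n ((n + 2) * (k + 1) + Suc r) d (p + r * Suc n) (Suc n - r)"
    by (simp add: dk)
  then have "lambda n d \<le> enat ((n + 2) * (k + 1) + Suc r)"
    using lambda_le [OF n] by (auto simp: reachable_def)
  then have "ereal_of_enat (lambda n d) \<le> ereal_of_enat (enat ((n + 2) * (k + 1) + Suc r))"
    by (simp only: ereal_of_enat_le_iff)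
  also have "\<dots> = ereal (real ((n + 2) * (k + 1) + Suc r))"
    by simp
  also have "real ((n + 2) * (k + 1) + Suc r) \<le> (real n + 2) / real n * real_of_int d + (2 * real n + 2)"
  proof -
    \<comment> \<open>The leading terms (n+2) k + r agree on both sides; what remains is that n + 3
      is at most 2 n + 2 plus a nonnegative term, which holds for n at least 1.\<close>
    have "(real n + 2) / real n * real_of_int d = (real n + 2) * real k + real r + 2 * real r / real n"
      using n by (simp add: dk field_simps)
    moreover have "real ((n + 2) * (k + 1) + Suc r) = (real n + 2) * real k + real r + real n + 3"
      by (simp add: algebra_simps)
    moreover have "0 \<le> 2 * real r / real n" "1 \<le> real n"
      using n by auto
    ultimately show ?thesis
      by linarith
  qed
  finally show ?thesis
    by simp
qed

theorem theorem1:
  fixes n :: nat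
  assumes "n \<ge> 1"
  shows "(\<forall>d::int. d \<ge> 0 \<longrightarrow>
            ereal_of_enat (lambda n d)
              \<le> ereal ((real n + 2) / real n * real_of_int d + (2 * real n + 2)))
         \<and> alpha n \<le> ereal ((real n + 2) / real n)"
proof
  let ?c = "(real n + 2) / real n"
  show "\<forall>d::int. d \<ge> 0 \<longrightarrow> ereal_of_enat (lambda n d) \<le> ereal (?c * real_of_int d + (2 * real n + 2))"
    using lambda_upper_bound [OF assms] by blast
  \<comment> \<open>The bound can be divided by d once d is positive, and the additive constant then
    contributes a term tending to 0.\<close>
  have "eventually (\<lambda>d. ereal_of_enat (lambda n (int d)) / ereal (real d) \<le>
            ereal (?c + (2 * real n + 2) / real d)) sequentially"
    using eventually_gt_at_top [of "0::nat"]
  proof eventually_elim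
    case (elim d)
    have "ereal_of_enat (lambda n (int d)) / ereal (real d) \<le>
          ereal (?c * real d + (2 * real n + 2)) / ereal (real d)"
      using lambda_upper_bound [OF assms, of "int d"] elim by (intro ereal_divide_right_mono) auto
    also have "\<dots> = ereal (?c + (2 * real n + 2) / real d)"
      using elim by (simp add: add_divide_distrib)
    finally show ?case .
  qed
  then have "alpha n \<le> limsup (\<lambda>d. ereal (?c + (2 * real n + 2) / real d))"
    unfolding alpha_def by (rule Limsup_mono)
  also have "(\<lambda>d. ereal (?c + (2 * real n + 2) / real d)) \<longlonglongrightarrow> ereal (?c + 0)"
    by (intro tendsto_intros tendsto_divide_0 [OF tendsto_const] filterlim_at_top_imp_at_infinity
        filterlim_real_sequentially)
  then have "limsup (\<lambda>d. ereal (?c + (2 * real n + 2) / real d)) = ereal (?c + 0)"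
    by (intro lim_imp_Limsup) auto
  finally show "alpha n \<le> ereal ?c"
    by simp
qed

end
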